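(* Let $\left[\left(\overline{a_0,a_1}\right),\left(\overline{b_0,b_1}\right)\right]$ be a purely periodic $2$-dimensional $p$-adic multidimensional continued fraction of period $2$, with characteristic polynomial $P(X)$. Then $P(X)$ is irreducible over $\mathbb{Q}$ unless the following condition is satisfied, possibly after interchanging the indices $0$ and $1$ (simultaneously in the $a$'s and the $b$'s): $\bullet$ $a_0=\pm\frac1p+w$ with $w\in\mathbb{Z}$, $|w|_\infty\le\frac{p-1}{2}$, $w\neq 0$; and $\bullet$ at least one of the following holds: (i) $v_p(a_1p+1)=v_p(a_1)+1$, and $v_p(b_1)=v_p(a_1)+1$, $v_p(b_0)=0$; (ii) $a_1=\pm\frac1p+u$ with $u\in\mathbb{Z}$, $|u|_\infty\le\frac{p-1}{2}$, $u\neq0$, and one of $b_0,b_1$ is zero and the other one is equal to $-wu\pm p$.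
   Context: Let $p$ be an odd prime, $v_p$ the $p$-adic valuation on $\mathbb{Q}_p$ ($v_p(0)=+\infty$), and $|\cdot|_\infty$ the usual Euclidean absolute value. Every $\alpha\in\mathbb{Q}_p$ can be written uniquely as $\alpha=\sum_{j=k}^{\infty}x_jp^j$ with $k\in\mathbb{Z}$ and $x_j\in\mathbb{Z}\cap(-\frac p2,\frac p2)$. The Browkin $s$-function is $s(\alpha)=\sum_{j=k}^{0}x_jp^j$ (the sum of the terms with $j\le 0$; it is $0$ if there are none); it takes values in $\mathbb{Z}[\frac1p]\cap(-\frac p2,\frac p2)$. $p$-adic Jacobi--Perron algorithm of dimension $2$: on input $(\alpha_0,\beta_0)\in\mathbb{Q}_p^2$, for $n=0,1,2,\ldots$ put $a_n=s(\alpha_n)$, $b_n=s(\beta_n)$ (partial quotients). If $\beta_n=b_n$ the algorithm stops; otherwise set $\alpha_{n+1}=\dfrac{1}{\beta_n-b_n}$ and $\beta_{n+1}=\dfrac{\alpha_n-a_n}{\beta_n-b_n}$, and continue. The multidimensional continued fraction of $(\alpha_0,\beta_0)$ is $[(a_0,a_1,\ldots),(b_0,b_1,\ldots)]$. It is purely periodic of period $N$, written $\left[\left(\overline{a_0,\ldots,a_{N-1}}\right),\left(\overline{b_0,\ldots,b_{N-1}}\right)\right]$, if the algorithm does not stop and $a_{k+N}=a_k$, $b_{k+N}=b_k$ for all $k\ge 0$. For period $2$ the characteristic polynomial $P(X)$ is the (monic) characteristic polynomial of $\mathcal{A}_0\mathcal{A}_1$, where $\mathcal{A}_n=\begin{pmatrix}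 a_n&1&0\\ b_n&0&1\\ 1&0&0\end{pmatrix}$. The signs $\pm$ occurring in different places of the condition are not required to be related. *)

theory Defs
  imports
    "HOL-Library.Extended_Real"
    "Berlekamp_Zassenhaus.Finite_Field"
    "Jordan_Normal_Form.Char_Poly"
begin

section \<open>The p-adic valuation on the rationals\<close>

definition rat_val :: "nat \<Rightarrow> rat \<Rightarrow> int" where
  "rat_val p x = int (multiplicity (int p) (fst (quotient_of x)))
               - int (multiplicity (int p) (snd (quotient_of x)))"

definition padic_val :: "nat \<Rightarrow> rat \<Rightarrow> ereal" where
  "padic_val p x = (if x = 0 then \<infinity> else ereal (of_int (rat_val p x)))"

definition padic_abs :: "nat \<Rightarrow> rat \<Rightarrow> real" where
  "padic_abs p x = (if x = 0 then 0 else real p powi (- rat_val p x))"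

lemma prime_int_not_unit: "prime p \<Longrightarrow> \<not> is_unit (int p)"
  using not_prime_unit[of "int p"] by auto

lemma rat_val_fraction:
  assumes p: "prime p" and a: "a \<noteq> 0" and b: "b \<noteq> 0"
  shows "rat_val p (of_int a / of_int b) = int (multiplicity (int p) a) - int (multiplicity (int p) b)"
proof -
  obtain c d where q: "quotient_of (of_int a / of_int b) = (c, d)" by fastforce
  have d: "d > 0" using quotient_of_denom_pos[OF q] .
  have eq: "(of_int a / of_int b :: rat) = of_int c / of_int d" using quotient_of_div[OF q] .
  hence "(of_int (a * d) :: rat) = of_int (c * b)"
    using b d by (simp add: field_simps)
  hence e: "a * d = c * b" by (simp only: of_int_eq_iff)
  have c: "c \<noteq> 0" using e a d by auto
  have pp: "prime_elem (int p)" using p by simp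
  have "multiplicity (int p) a + multiplicity (int p) d = multiplicity (int p) c + multiplicity (int p) b"
    using e prime_elem_multiplicity_mult_distrib[OF pp] a b c d by (metis less_irrefl)
  thus ?thesis unfolding rat_val_def q by simp
qed

lemma rat_fraction_cases:
  fixes x :: rat
  obtains a b where "x = of_int a / of_int b" "b > 0"
  by (metis quotient_of_denom_pos quotient_of_div surj_pair)

lemma rat_val_mult:
  assumes p: "prime p" and x: "x \<noteq> 0" and y: "y \<noteq> 0"
  shows "rat_val p (x * y) = rat_val p x + rat_val p y"
proof -
  obtain a b where 1: "x = of_int a / of_int b" "b > 0" by (rule rat_fraction_cases)
  obtain c d where 2: "y = of_int c / of_int d" "d > 0" by (rule rat_fraction_cases)
  have nz: "a \<noteq> 0" "c \<noteq> 0" "b \<noteq> 0" "d \<noteq> 0" using 1 2 x y by auto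
  have pp: "prime_elem (int p)" using p by simp
  have "x * y = of_int (a * c) / of_int (b * d)" using 1 2 by simp
  hence "rat_val p (x * y) = int (multiplicity (int p) (a * c)) - int (multiplicity (int p) (b * d))"
    using rat_val_fraction[OF p, of "a * c" "b * d"] nz by simp
  thus ?thesis
    using nz unfolding 1 2 rat_val_fraction[OF p nz(1,3)] rat_val_fraction[OF p nz(2,4)]
    by (simp add: prime_elem_multiplicity_mult_distrib[OF pp])
qed

lemma rat_val_add:
  assumes p: "prime p" and x: "x \<noteq> 0" and y: "y \<noteq> 0" and xy: "x + y \<noteq> 0"
  shows "min (rat_val p x) (rat_val p y) \<le> rat_val p (x + y)"
proof -
  obtain a b where 1: "x = of_int a / of_int b" "b > 0" by (rule rat_fraction_cases)
  obtain c d where 2: "y = of_int c / of_int d" "d > 0" by (rule rat_fraction_cases)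
  have nz: "b * d \<noteq> 0" using 1 2 by auto
  have x': "x = of_int (a * d) / of_int (b * d)" and y': "y = of_int (c * b) / of_int (b * d)"
    using 1 2 by (simp_all add: field_simps)
  have s': "x + y = of_int (a * d + c * b) / of_int (b * d)"
    unfolding x' y' by (simp only: of_int_add add_divide_distrib)
  have nz': "a * d \<noteq> 0" "c * b \<noteq> 0" "a * d + c * b \<noteq> 0"
    using x y xy x' y' s' by (metis div_0 of_int_0)+
  define m where "m = min (multiplicity (int p) (a * d)) (multiplicity (int p) (c * b))"
  have "int p ^ m dvd a * d" "int p ^ m dvd c * b"
    by (simp_all add: m_def multiplicity_dvd')
  hence "int p ^ m dvd a * d + c * b" by (rule dvd_add)
  moreover have "\<not> is_unit (int p)" using p by (rule prime_int_not_unit)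
  ultimately have "m \<le> multiplicity (int p) (a * d + c * b)"
    using nz' by (intro multiplicity_geI) auto
  thus ?thesis
    unfolding x' y' s'[unfolded x' y'] rat_val_fraction[OF p nz'(1) nz] rat_val_fraction[OF p nz'(2) nz]
      rat_val_fraction[OF p nz'(3) nz]
    by (simp add: m_def min_def split: if_splits)
qed

lemma padic_abs_0 [simp]: "padic_abs p 0 = 0"
  by (simp add: padic_abs_def)

lemma padic_abs_nonneg [simp]: "0 \<le> padic_abs p x"
  by (simp add: padic_abs_def)

lemma padic_abs_eq_0 [simp]: "prime p \<Longrightarrow> padic_abs p x = 0 \<longleftrightarrow> x = 0"
  by (auto simp: padic_abs_def dest: prime_gt_0_nat)

lemma padic_abs_mult: "prime p \<Longrightarrow> padic_abs p (x * y) = padic_abs p x * padic_abs p y"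
  by (auto simp: padic_abs_def rat_val_mult simp flip: power_int_add dest: prime_gt_0_nat)

lemma padic_abs_1 [simp]: "prime p \<Longrightarrow> padic_abs p 1 = 1"
  by (simp add: padic_abs_def rat_val_def)

lemma padic_abs_minus_1: assumes p: "prime p" shows "padic_abs p (- 1) = 1"
proof -
  have "padic_abs p (-1) * padic_abs p (-1) = 1" using padic_abs_mult[OF p, of "-1" "-1"] p by simp
  thus ?thesis using padic_abs_nonneg[of p "-1"] by (simp add: square_eq_1_iff)
qed

lemma padic_abs_minus [simp]: "prime p \<Longrightarrow> padic_abs p (- x) = padic_abs p x"
  using padic_abs_mult[of p "-1" x] by (simp add: padic_abs_minus_1)

lemma padic_abs_minus_commute: "prime p \<Longrightarrow> padic_abs p (x - y) = padic_abs p (y - x)"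
  using padic_abs_minus[of p "x - y"] by simp

lemma padic_abs_inverse: "prime p \<Longrightarrow> padic_abs p (inverse x) = inverse (padic_abs p x)"
  using padic_abs_mult[of p x "inverse x"] by (cases "x = 0") (auto simp: field_simps)

lemma padic_abs_add: 
  assumes p: "prime p" shows "padic_abs p (x + y) \<le> max (padic_abs p x) (padic_abs p y)"
proof (cases "x = 0 \<or> y = 0 \<or> x + y = 0")
  case True
  thus ?thesis by (auto simp: le_max_iff_disj)
next
  case False
  have p1: "1 \<le> real p" using prime_ge_1_nat[OF p] by simp
  from False have "min (rat_val p x) (rat_val p y) \<le> rat_val p (x + y)"
    using rat_val_add[OF p] by blast
  hence "- rat_val p (x + y) \<le> - rat_val p x \<or> - rat_val p (x + y) \<le> - rat_val p y"
    by linarith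
  thus ?thesis using False p1
    by (auto simp: padic_abs_def le_max_iff_disj intro: power_int_increasing)
qed

lemma padic_abs_diff:
  "prime p \<Longrightarrow> padic_abs p (x - y) \<le> max (padic_abs p x) (padic_abs p y)"
  using padic_abs_add[of p x "- y"] by simp


section \<open>The field of p-adic numbers\<close>

definition padic_vanishes :: "nat \<Rightarrow> (nat \<Rightarrow> rat) \<Rightarrow> bool" where
  "padic_vanishes p X \<longleftrightarrow> (\<lambda>n. padic_abs p (X n)) \<longlonglongrightarrow> 0"

definition padic_Cauchy :: "nat \<Rightarrow> (nat \<Rightarrow> rat) \<Rightarrow> bool" where
  "padic_Cauchy p X \<longleftrightarrow> (\<forall>e>0. \<exists>N. \<forall>m\<ge>N. \<forall>n\<ge>N. padic_abs p (X m - X n) < e)"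

lemma padic_vanishes_altdef:
  "padic_vanishes p X \<longleftrightarrow> (\<forall>e>0. \<exists>N. \<forall>n\<ge>N. padic_abs p (X n) < e)"
  unfolding padic_vanishes_def LIMSEQ_iff by simp

lemma padic_vanishes_bound:
  assumes "padic_vanishes p X" and "\<And>n. padic_abs p (Y n) \<le> padic_abs p (X n) * C"
  shows "padic_vanishes p Y"
proof -
  have "(\<lambda>n. padic_abs p (X n) * C) \<longlonglongrightarrow> 0 * C"
    using assms(1) unfolding padic_vanishes_def by (intro tendsto_mult tendsto_const)
  thus ?thesis unfolding padic_vanishes_def
    by (intro real_tendsto_sandwich[of "\<lambda>_. 0" "\<lambda>n. padic_abs p (Y n)" sequentially
          "\<lambda>n. padic_abs p (X n) * C"]) (use assms(2) in auto)
qed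

lemma padic_vanishes_add:
  assumes p: "prime p" and X: "padic_vanishes p X" and Y: "padic_vanishes p Y"
  shows "padic_vanishes p (\<lambda>n. X n + Y n)"
proof -
  have "(\<lambda>n. max (padic_abs p (X n)) (padic_abs p (Y n))) \<longlonglongrightarrow> max 0 0"
    using X Y unfolding padic_vanishes_def by (intro tendsto_max)
  thus ?thesis unfolding padic_vanishes_def
    by (intro real_tendsto_sandwich[of "\<lambda>_. 0" "\<lambda>n. padic_abs p (X n + Y n)" sequentially
          "\<lambda>n. max (padic_abs p (X n)) (padic_abs p (Y n))"]) (use padic_abs_add[OF p] in auto)
qed

lemma padic_vanishes_minus: "prime p \<Longrightarrow> padic_vanishes p X \<Longrightarrow> padic_vanishes p (\<lambda>n. - X n)"
  unfolding padic_vanishes_def by simp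

lemma padic_vanishes_diff:
  "prime p \<Longrightarrow> padic_vanishes p X \<Longrightarrow> padic_vanishes p Y \<Longrightarrow> padic_vanishes p (\<lambda>n. X n - Y n)"
  using padic_vanishes_add[of p X "\<lambda>n. - Y n"] padic_vanishes_minus[of p Y] by simp

lemma padic_vanishes_mult:
  assumes p: "prime p" and X: "padic_vanishes p X" and Y: "\<And>n. padic_abs p (Y n) \<le> C"
  shows "padic_vanishes p (\<lambda>n. X n * Y n)" "padic_vanishes p (\<lambda>n. Y n * X n)"
proof -
  show "padic_vanishes p (\<lambda>n. X n * Y n)"
    by (rule padic_vanishes_bound[OF X, of _ C])
       (auto simp: padic_abs_mult[OF p] intro: mult_left_mono[OF Y])
  thus "padic_vanishes p (\<lambda>n. Y n * X n)" by (simp add: mult.commute)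
qed

lemma padic_Cauchy_const [simp]: "padic_Cauchy p (\<lambda>_. c)"
  by (simp add: padic_Cauchy_def)

lemma padic_Cauchy_add:
  assumes p: "prime p" and X: "padic_Cauchy p X" and Y: "padic_Cauchy p Y"
  shows "padic_Cauchy p (\<lambda>n. X n + Y n)"
  unfolding padic_Cauchy_def
proof (intro allI impI)
  fix e :: real assume e: "e > 0"
  obtain M where M: "\<forall>m\<ge>M. \<forall>n\<ge>M. padic_abs p (X m - X n) < e"
    using X e unfolding padic_Cauchy_def by blast
  obtain N where N: "\<forall>m\<ge>N. \<forall>n\<ge>N. padic_abs p (Y m - Y n) < e"
    using Y e unfolding padic_Cauchy_def by blast
  have "padic_abs p ((X m + Y m) - (X n + Y n)) < e" if "m \<ge> max M N" "n \<ge> max M N" for m n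
  proof -
    have "padic_abs p ((X m - X n) + (Y m - Y n)) \<le> max (padic_abs p (X m - X n)) (padic_abs p (Y m - Y n))"
      by (rule padic_abs_add[OF p])
    also have "\<dots> < e" using M N that by simp
    finally show ?thesis by (simp add: algebra_simps)
  qed
  thus "\<exists>N. \<forall>m\<ge>N. \<forall>n\<ge>N. padic_abs p ((X m + Y m) - (X n + Y n)) < e" by blast
qed

lemma padic_Cauchy_minus:
  assumes p: "prime p" and X: "padic_Cauchy p X"
  shows "padic_Cauchy p (\<lambda>n. - X n)"
proof -
  have "padic_abs p (- X m - - X n) = padic_abs p (X m - X n)" for m n
    using padic_abs_minus_commute[OF p, of "X m" "X n"] by simp
  thus ?thesis using X unfolding padic_Cauchy_def by simp
qed

lemma padic_Cauchy_diff:
  "prime p \<Longrightarrow> padic_Cauchy p X \<Longrightarrow> padic_Cauchy p Y \<Longrightarrow> padic_Cauchy p (\<lambda>n. X n - Y n)"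
  using padic_Cauchy_add[of p X "\<lambda>n. - Y n"] padic_Cauchy_minus[of p Y] by simp

lemma padic_Cauchy_bounded:
  assumes p: "prime p" and X: "padic_Cauchy p X"
  obtains C where "C > 0" "\<And>n. padic_abs p (X n) \<le> C"
proof -
  obtain N where N: "\<forall>m\<ge>N. \<forall>n\<ge>N. padic_abs p (X m - X n) < 1"
    using X[unfolded padic_Cauchy_def, THEN spec, of 1] by auto
  define C where "C = Max (insert 1 ((\<lambda>n. padic_abs p (X n)) ` {..N}))"
  have C1: "C \<ge> 1" unfolding C_def by (rule Max_ge) auto
  have C2: "padic_abs p (X n) \<le> C" if "n \<le> N" for n
    unfolding C_def by (rule Max_ge) (use that in auto)
  have "padic_abs p (X n) \<le> C" for n
  proof (cases "n \<le> N")
    case False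
    have "padic_abs p ((X n - X N) + X N) \<le> max (padic_abs p (X n - X N)) (padic_abs p (X N))"
      by (rule padic_abs_add[OF p])
    moreover have "padic_abs p (X n - X N) < 1" using N False by simp
    moreover have "padic_abs p (X N) \<le> C" using C2 by simp
    ultimately show ?thesis using C1 by simp
  qed (use C2 in auto)
  thus ?thesis using C1 by (intro that[of C]) auto
qed

lemma padic_Cauchy_mult:
  assumes p: "prime p" and X: "padic_Cauchy p X" and Y: "padic_Cauchy p Y"
  shows "padic_Cauchy p (\<lambda>n. X n * Y n)"
proof -
  obtain A where A: "A > 0" "\<And>n. padic_abs p (X n) \<le> A" using padic_Cauchy_bounded[OF p X] by blast
  obtain B where B: "B > 0" "\<And>n. padic_abs p (Y n) \<le> B" using padic_Cauchy_bounded[OF p Y] by blast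
  show ?thesis unfolding padic_Cauchy_def
  proof (intro allI impI)
    fix e :: real assume e: "e > 0"
    obtain M where M: "\<forall>m\<ge>M. \<forall>n\<ge>M. padic_abs p (X m - X n) < e / B"
      using X e B unfolding padic_Cauchy_def by (meson divide_pos_pos)
    obtain N where N: "\<forall>m\<ge>N. \<forall>n\<ge>N. padic_abs p (Y m - Y n) < e / A"
      using Y e A unfolding padic_Cauchy_def by (meson divide_pos_pos)
    have "padic_abs p (X m * Y m - X n * Y n) < e" if mn: "m \<ge> max M N" "n \<ge> max M N" for m n
    proof -
      have "padic_abs p ((X m - X n) * Y m) < e"
      proof -
        have "padic_abs p ((X m - X n) * Y m) \<le> padic_abs p (X m - X n) * B"
          unfolding padic_abs_mult[OF p] by (intro mult_left_mono B) simp
        also have "\<dots> < e / B * B" using M mn B by (intro mult_strict_right_mono) auto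
        finally show ?thesis using B by simp
      qed
      moreover have "padic_abs p (X n * (Y m - Y n)) < e"
      proof -
        have "padic_abs p (X n * (Y m - Y n)) \<le> A * padic_abs p (Y m - Y n)"
          unfolding padic_abs_mult[OF p] by (intro mult_right_mono A) simp
        also have "\<dots> < A * (e / A)" using N mn A by (intro mult_strict_left_mono) auto
        finally show ?thesis using A by simp
      qed
      moreover have "X m * Y m - X n * Y n = (X m - X n) * Y m + X n * (Y m - Y n)"
        by (simp add: algebra_simps)
      ultimately show ?thesis using padic_abs_add[OF p, of "(X m - X n) * Y m" "X n * (Y m - Y n)"]
        by simp
    qed
    thus "\<exists>N. \<forall>m\<ge>N. \<forall>n\<ge>N. padic_abs p (X m * Y m - X n * Y n) < e" by blast
  qed
qed

lemma padic_abs_eqI: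
  assumes p: "prime p" and "padic_abs p (x - y) < padic_abs p y"
  shows "padic_abs p x = padic_abs p y"
  using padic_abs_add[OF p, of "x - y" y] padic_abs_diff[OF p, of x "x - y"] assms by simp

lemma padic_Cauchy_not_vanishes:
  assumes p: "prime p" and X: "padic_Cauchy p X" and nz: "\<not> padic_vanishes p X"
  obtains c N where "c > 0" "\<And>n. n \<ge> N \<Longrightarrow> padic_abs p (X n) = c"
proof -
  obtain e where e: "e > 0" "\<And>N. \<exists>n\<ge>N. padic_abs p (X n) \<ge> e"
    using nz unfolding padic_vanishes_altdef by (meson not_less)
  obtain N where N: "\<forall>m\<ge>N. \<forall>n\<ge>N. padic_abs p (X m - X n) < e"
    using X e unfolding padic_Cauchy_def by blast
  obtain k where k: "k \<ge> N" "padic_abs p (X k) \<ge> e" using e(2) by blast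
  have "padic_abs p (X n) = padic_abs p (X k)" if "n \<ge> N" for n
    using N k that by (intro padic_abs_eqI[OF p]) force
  thus ?thesis using k(2) e(1) by (intro that[of "padic_abs p (X k)" N]) auto
qed

lemma padic_Cauchy_inverse:
  assumes p: "prime p" and X: "padic_Cauchy p X" and nz: "\<not> padic_vanishes p X"
  shows "padic_Cauchy p (\<lambda>n. inverse (X n))"
proof -
  obtain c M where c: "c > 0" and M: "\<And>n. n \<ge> M \<Longrightarrow> padic_abs p (X n) = c"
    using padic_Cauchy_not_vanishes[OF assms] by blast
  show ?thesis unfolding padic_Cauchy_def
  proof (intro allI impI)
    fix e :: real assume e: "e > 0"
    obtain N where N: "\<forall>m\<ge>N. \<forall>n\<ge>N. padic_abs p (X m - X n) < c * c * e"
      using X e c unfolding padic_Cauchy_def by (meson mult_pos_pos)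
    have "padic_abs p (inverse (X m) - inverse (X n)) < e" if mn: "m \<ge> max M N" "n \<ge> max M N" for m n
    proof -
      have nz: "X m \<noteq> 0" "X n \<noteq> 0" using M[of m] M[of n] mn c by auto
      have "inverse (X m) - inverse (X n) = (X n - X m) * inverse (X m * X n)"
        using nz by (simp add: field_simps)
      hence "padic_abs p (inverse (X m) - inverse (X n))
               = padic_abs p (X n - X m) * inverse (padic_abs p (X m) * padic_abs p (X n))"
        by (simp only: padic_abs_mult[OF p] padic_abs_inverse[OF p])
      also have "\<dots> = padic_abs p (X n - X m) / (c * c)"
        using M mn by (simp add: divide_inverse)
      also have "\<dots> < e" using N mn c by (simp add: field_simps)
      finally show ?thesis .
    qed
    thus "\<exists>N. \<forall>m\<ge>N. \<forall>n\<ge>N. padic_abs p (inverse (X m) - inverse (X n)) < e" by blast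
  qed
qed

lemma padic_abs_convergent:
  assumes p: "prime p" and X: "padic_Cauchy p X"
  shows "convergent (\<lambda>n. padic_abs p (X n))"
proof (cases "padic_vanishes p X")
  case True
  thus ?thesis unfolding padic_vanishes_def by (rule convergentI)
next
  case False
  obtain c N where "c > 0" "\<And>n. n \<ge> N \<Longrightarrow> padic_abs p (X n) = c"
    using padic_Cauchy_not_vanishes[OF p X False] by blast
  hence "(\<lambda>n. padic_abs p (X n)) \<longlonglongrightarrow> c"
    by (intro tendsto_eventually) (auto simp: eventually_sequentially)
  thus ?thesis by (rule convergentI)
qed

typedef ('p::prime_card) padic_seq = "{X. padic_Cauchy CARD('p) X}"
  by (intro exI[of _ "\<lambda>_. 0"]) simp

setup_lifting type_definition_padic_seq

lift_definition padic_seq_eq :: "'p::prime_card padic_seq \<Rightarrow> 'p padic_seq \<Rightarrow> bool"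
  is "\<lambda>X Y. padic_vanishes CARD('p) (\<lambda>n. X n - Y n)" .

lift_definition padic_seq_const :: "rat \<Rightarrow> 'p::prime_card padic_seq"
  is "\<lambda>q _. q" by simp

lift_definition padic_seq_add :: "'p::prime_card padic_seq \<Rightarrow> 'p padic_seq \<Rightarrow> 'p padic_seq"
  is "\<lambda>X Y n. X n + Y n" by (rule padic_Cauchy_add[OF prime_card])

lift_definition padic_seq_minus :: "'p::prime_card padic_seq \<Rightarrow> 'p padic_seq"
  is "\<lambda>X n. - X n" by (rule padic_Cauchy_minus[OF prime_card])

lift_definition padic_seq_diff :: "'p::prime_card padic_seq \<Rightarrow> 'p padic_seq \<Rightarrow> 'p padic_seq"
  is "\<lambda>X Y n. X n - Y n" by (rule padic_Cauchy_diff[OF prime_card])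

lift_definition padic_seq_mult :: "'p::prime_card padic_seq \<Rightarrow> 'p padic_seq \<Rightarrow> 'p padic_seq"
  is "\<lambda>X Y n. X n * Y n" by (rule padic_Cauchy_mult[OF prime_card])

lift_definition padic_seq_inverse :: "'p::prime_card padic_seq \<Rightarrow> 'p padic_seq"
  is "\<lambda>X. if padic_vanishes CARD('p) X then (\<lambda>_. 0) else (\<lambda>n. inverse (X n))"
  by (simp split: if_split add: padic_Cauchy_inverse[OF prime_card[where 'a = 'p]])

lift_definition padic_seq_norm :: "'p::prime_card padic_seq \<Rightarrow> real"
  is "\<lambda>X. lim (\<lambda>n. padic_abs CARD('p) (X n))" .

(* The field of p-adic numbers for p = CARD('p): p-adic Cauchy sequences of rationals modulo null
   sequences. The prime is carried by the type argument, so "for every prime p" is expressed by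
   quantification over 'p :: prime_card. *)
quotient_type 'p padic = "'p::prime_card padic_seq" / padic_seq_eq
proof (rule equivpI)
  note p = prime_card[where 'a = 'p]
  show "reflp (padic_seq_eq :: 'p padic_seq \<Rightarrow> _)"
    unfolding reflp_def by transfer (simp add: padic_vanishes_def)
  show "symp (padic_seq_eq :: 'p padic_seq \<Rightarrow> _)"
    unfolding symp_def by transfer (simp add: padic_vanishes_def padic_abs_minus_commute[OF p])
  show "transp (padic_seq_eq :: 'p padic_seq \<Rightarrow> _)"
  proof (rule transpI)
    fix X Y Z :: "'p padic_seq"
    assume "padic_seq_eq X Y" "padic_seq_eq Y Z"
    thus "padic_seq_eq X Z"
      using padic_vanishes_add[OF p, of "\<lambda>n. Rep_padic_seq X n - Rep_padic_seq Y n"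
          "\<lambda>n. Rep_padic_seq Y n - Rep_padic_seq Z n"]
      by (simp add: padic_seq_eq.rep_eq)
  qed
qed

lemma padic_seq_inverse_cong:
  assumes p: "prime p" and X: "padic_Cauchy p X" and Y: "padic_Cauchy p Y"
    and XY: "padic_vanishes p (\<lambda>n. X n - Y n)" and nX: "\<not> padic_vanishes p X" and nY: "\<not> padic_vanishes p Y"
  shows "padic_vanishes p (\<lambda>n. inverse (X n) - inverse (Y n))"
proof -
  obtain c M where c: "c > 0" "\<And>n. n \<ge> M \<Longrightarrow> padic_abs p (X n) = c"
    using padic_Cauchy_not_vanishes[OF p X nX] by blast
  obtain d N where d: "d > 0" "\<And>n. n \<ge> N \<Longrightarrow> padic_abs p (Y n) = d"
    using padic_Cauchy_not_vanishes[OF p Y nY] by blast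
  have eq: "padic_abs p (inverse (X n) - inverse (Y n)) = padic_abs p (X n - Y n) / (c * d)"
    if "n \<ge> max M N" for n
  proof -
    have nz: "X n \<noteq> 0" "Y n \<noteq> 0" using c(2)[of n] d(2)[of n] c(1) d(1) that by auto
    have "inverse (X n) - inverse (Y n) = (Y n - X n) * inverse (X n * Y n)"
      using nz by (simp add: field_simps)
    hence "padic_abs p (inverse (X n) - inverse (Y n))
             = padic_abs p (Y n - X n) * inverse (padic_abs p (X n) * padic_abs p (Y n))"
      by (simp only: padic_abs_mult[OF p] padic_abs_inverse[OF p])
    thus ?thesis using c d that
      by (simp add: divide_inverse padic_abs_minus_commute[OF p, of "X n"])
  qed
  have "(\<lambda>n. padic_abs p (X n - Y n) / (c * d)) \<longlonglongrightarrow> 0 / (c * d)"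
    using XY c d unfolding padic_vanishes_def by (intro tendsto_divide tendsto_const) auto
  hence "(\<lambda>n. padic_abs p (X n - Y n) / (c * d)) \<longlonglongrightarrow> 0" by simp
  thus ?thesis unfolding padic_vanishes_def
    by (rule Lim_transform_eventually) (use eq in \<open>auto simp: eventually_sequentially intro!: exI[of _ "max M N"]\<close>)
qed

lemma padic_vanishes_cong:
  assumes p: "prime p" and XY: "padic_vanishes p (\<lambda>n. X n - Y n)"
  shows "padic_vanishes p X \<longleftrightarrow> padic_vanishes p Y"
  using padic_vanishes_add[OF p XY, of Y] padic_vanishes_diff[OF p _ XY, of X] by auto

instantiation padic :: (prime_card) field
begin

lift_definition zero_padic :: "'a padic" is "padic_seq_const 0" .

lift_definition one_padic :: "'a padic" is "padic_seq_const 1" .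

lift_definition plus_padic :: "'a padic \<Rightarrow> 'a padic \<Rightarrow> 'a padic" is padic_seq_add
proof (transfer, goal_cases)
  case (1 X X' Y Y')
  thus ?case using padic_vanishes_add[OF prime_card[where 'a = 'a], of "\<lambda>n. X n - X' n" "\<lambda>n. Y n - Y' n"]
    by (simp add: algebra_simps)
qed

lift_definition uminus_padic :: "'a padic \<Rightarrow> 'a padic" is padic_seq_minus
proof (transfer, goal_cases)
  case (1 X X')
  thus ?case using padic_vanishes_minus[OF prime_card[where 'a = 'a], of "\<lambda>n. X n - X' n"]
    by (simp add: algebra_simps)
qed

lift_definition minus_padic :: "'a padic \<Rightarrow> 'a padic \<Rightarrow> 'a padic" is padic_seq_diff
proof (transfer, goal_cases)
  case (1 X X' Y Y')
  thus ?case using padic_vanishes_diff[OF prime_card[where 'a = 'a], of "\<lambda>n. X n - X' n" "\<lambda>n. Y n - Y' n"]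
    by (simp add: algebra_simps)
qed

lift_definition times_padic :: "'a padic \<Rightarrow> 'a padic \<Rightarrow> 'a padic" is padic_seq_mult
proof (transfer, goal_cases)
  case (1 X X' Y Y')
  note p = prime_card[where 'a = 'a]
  obtain A where A: "A > 0" "\<And>n. padic_abs CARD('a) (X' n) \<le> A" using padic_Cauchy_bounded[OF p 1(2)] by blast
  obtain B where B: "B > 0" "\<And>n. padic_abs CARD('a) (Y n) \<le> B" using padic_Cauchy_bounded[OF p 1(3)] by blast
  have "padic_vanishes CARD('a) (\<lambda>n. (X n - X' n) * Y n + X' n * (Y n - Y' n))"
    by (intro padic_vanishes_add[OF p] padic_vanishes_mult(1)[OF p 1(5) B(2)] padic_vanishes_mult(2)[OF p 1(6) A(2)])
  thus ?case by (simp add: algebra_simps)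
qed

lift_definition inverse_padic :: "'a padic \<Rightarrow> 'a padic" is padic_seq_inverse
proof (transfer, goal_cases)
  case (1 X X')
  thus ?case using padic_seq_inverse_cong[OF prime_card 1] padic_vanishes_cong[OF prime_card 1(3)]
    by (simp add: padic_vanishes_def)
qed

definition divide_padic :: "'a padic \<Rightarrow> 'a padic \<Rightarrow> 'a padic" where
  "divide_padic x y = x * inverse y"

instance
proof
  fix a b c :: "'a padic"
  show "a + b + c = a + (b + c)"
    by (transfer, transfer) (simp add: padic_vanishes_def)
  show "a + b = b + a"
    by (transfer, transfer) (simp add: padic_vanishes_def)
  show "0 + a = a"
    by (transfer, transfer) (simp add: padic_vanishes_def)
  show "- a + a = 0"
    by (transfer, transfer) (simp add: padic_vanishes_def)
  show "a - b = a + - b"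
    by (transfer, transfer) (simp add: padic_vanishes_def)
  show "a * b * c = a * (b * c)"
    by (transfer, transfer) (simp add: padic_vanishes_def mult.assoc)
  show "a * b = b * a"
    by (transfer, transfer) (simp add: padic_vanishes_def mult.commute)
  show "1 * a = a"
    by (transfer, transfer) (simp add: padic_vanishes_def)
  show "(a + b) * c = a * c + b * c"
    by (transfer, transfer) (simp add: padic_vanishes_def algebra_simps)
  show "(0::'a padic) \<noteq> 1"
    by (transfer, transfer) (simp add: padic_vanishes_def padic_abs_minus_1 prime_card LIMSEQ_const_iff)
  show "inverse (0::'a padic) = 0"
    by (transfer, transfer) (simp add: padic_vanishes_def)
  show "a div b = a * inverse b"
    by (rule divide_padic_def)
  show "inverse a * a = 1" if "a \<noteq> 0"
    using that
  proof (transfer, transfer)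
    fix X :: "nat \<Rightarrow> rat"
    assume X: "padic_Cauchy CARD('a) X" and nz: "\<not> padic_vanishes CARD('a) (\<lambda>n. X n - 0)"
    obtain c N where c: "c > 0" "\<And>n. n \<ge> N \<Longrightarrow> padic_abs CARD('a) (X n) = c"
      using padic_Cauchy_not_vanishes[OF prime_card X] nz by auto
    have "inverse (X n) * X n = 1" if "n \<ge> N" for n
      using c(1) c(2)[OF that] by (cases "X n = 0") auto
    hence "(\<lambda>n. padic_abs CARD('a) (inverse (X n) * X n - 1)) \<longlonglongrightarrow> 0"
      by (intro tendsto_eventually) (auto simp: eventually_sequentially intro!: exI[of _ N])
    thus "padic_vanishes CARD('a)
            (\<lambda>n. (if padic_vanishes CARD('a) X then \<lambda>_. 0 else (\<lambda>n. inverse (X n))) n * X n - 1)"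
      using nz by (simp add: padic_vanishes_def)
  qed
qed

end

lift_definition padic_of_rat :: "rat \<Rightarrow> 'p::prime_card padic" is padic_seq_const .

lemma padic_of_rat_simps:
  "padic_of_rat 0 = 0" "padic_of_rat 1 = 1"
  "padic_of_rat (x + y) = padic_of_rat x + padic_of_rat y"
  "padic_of_rat (x * y) = padic_of_rat x * padic_of_rat y"
  "padic_of_rat (- x) = - padic_of_rat x"
  by (transfer, transfer, simp add: padic_vanishes_def)+

lemma padic_of_rat_eq_0: "padic_of_rat x = (0 :: 'p::prime_card padic) \<longleftrightarrow> x = 0"
  by (transfer, transfer) (simp add: padic_vanishes_def LIMSEQ_const_iff prime_card)

lemma padic_of_rat_of_nat: "padic_of_rat (of_nat n) = of_nat n"
  by (induction n) (simp_all add: padic_of_rat_simps)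

instance padic :: (prime_card) field_char_0
proof
  show "inj (of_nat :: nat \<Rightarrow> 'a padic)"
  proof (rule injI)
    fix m n :: nat
    assume "(of_nat m :: 'a padic) = of_nat n"
    hence "padic_of_rat (of_nat m + - of_nat n) = (0 :: 'a padic)"
      by (simp only: padic_of_rat_simps padic_of_rat_of_nat) simp
    thus "m = n" unfolding padic_of_rat_eq_0 by simp
  qed
qed

lemma padic_of_rat_of_int: "padic_of_rat (of_int n) = (of_int n :: 'a::prime_card padic)"
proof -
  obtain a b where n: "n = int a - int b" by (cases n rule: int_diff_cases)
  have "padic_of_rat (of_int n) = (padic_of_rat (of_nat a + - of_nat b) :: 'a padic)"
    by (simp add: n)
  also have "\<dots> = of_nat a - of_nat b"
    by (simp only: padic_of_rat_simps padic_of_rat_of_nat) simp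
  finally show ?thesis by (simp add: n)
qed

lemma padic_of_rat_eq_of_rat: "padic_of_rat x = of_rat x"
proof -
  obtain a b where x: "x = of_int a / of_int b" "b > 0" by (rule rat_fraction_cases)
  have "padic_of_rat x * of_int b = (padic_of_rat (x * of_int b) :: 'a padic)"
    by (simp only: padic_of_rat_simps padic_of_rat_of_int)
  also have "x * of_int b = of_int a" using x by simp
  finally have "padic_of_rat x = (of_int a / of_int b :: 'a padic)"
    using x(2) by (simp add: field_simps padic_of_rat_of_int)
  thus ?thesis using x by (simp add: of_rat_divide)
qed

lemma padic_seq_norm_tendsto:
  "(\<lambda>n. padic_abs CARD('p) (Rep_padic_seq X n)) \<longlonglongrightarrow> padic_seq_norm (X :: 'p::prime_card padic_seq)"
  using padic_abs_convergent[OF prime_card, of "Rep_padic_seq X"] Rep_padic_seq[of X]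
  by (simp add: padic_seq_norm.rep_eq convergent_LIMSEQ_iff)

lemma padic_seq_norm_eqI:
  fixes X :: "'p::prime_card padic_seq"
  shows "(\<lambda>n. padic_abs CARD('p) (Rep_padic_seq X n)) \<longlonglongrightarrow> c \<Longrightarrow> padic_seq_norm X = c"
  using LIMSEQ_unique padic_seq_norm_tendsto by blast

lift_definition padic_norm :: "'a::prime_card padic \<Rightarrow> real" is padic_seq_norm
proof -
  note p = prime_card[where 'a = 'a]
  fix X Y :: "'a padic_seq" assume "padic_seq_eq X Y"
  hence *: "padic_vanishes CARD('a) (\<lambda>n. Rep_padic_seq X n - Rep_padic_seq Y n)"
    by (simp add: padic_seq_eq.rep_eq)
  show "padic_seq_norm X = padic_seq_norm Y"
  proof (cases "padic_vanishes CARD('a) (Rep_padic_seq Y)")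
    case True
    with padic_vanishes_cong[OF p *] have "padic_seq_norm X = 0" "padic_seq_norm Y = 0"
      by (auto simp: padic_vanishes_def intro: padic_seq_norm_eqI)
    thus ?thesis by simp
  next
    case False
    have "padic_Cauchy CARD('a) (Rep_padic_seq Y)" using Rep_padic_seq[of Y] by simp
    then obtain c N where c: "c > 0" "\<And>n. n \<ge> N \<Longrightarrow> padic_abs CARD('a) (Rep_padic_seq Y n) = c"
      using padic_Cauchy_not_vanishes[OF p _ False] by blast
    obtain M where M: "\<And>n. n \<ge> M \<Longrightarrow> padic_abs CARD('a) (Rep_padic_seq X n - Rep_padic_seq Y n) < c"
      using * c(1) unfolding padic_vanishes_altdef by blast
    have "padic_abs CARD('a) (Rep_padic_seq X n) = c" if "n \<ge> max M N" for n
      using padic_abs_eqI[OF p, of "Rep_padic_seq X n" "Rep_padic_seq Y n"] M c that by simp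
    hence "(\<lambda>n. padic_abs CARD('a) (Rep_padic_seq X n)) \<longlonglongrightarrow> c"
      by (intro tendsto_eventually) (auto simp: eventually_sequentially intro!: exI[of _ "max M N"])
    moreover have "(\<lambda>n. padic_abs CARD('a) (Rep_padic_seq Y n)) \<longlonglongrightarrow> c"
      using c by (intro tendsto_eventually) (auto simp: eventually_sequentially)
    ultimately show ?thesis by (simp add: padic_seq_norm_eqI)
  qed
qed

context
  fixes x y :: "'p::prime_card padic"
begin

lemma padic_norm_nonneg [simp]: "0 \<le> padic_norm x"
  by transfer (rule LIMSEQ_le_const[OF padic_seq_norm_tendsto], simp)

lemma padic_norm_eq_0 [simp]: "padic_norm x = 0 \<longleftrightarrow> x = 0"
proof (transfer)
  fix X :: "'p padic_seq"
  show "padic_seq_norm X = 0 \<longleftrightarrow> padic_seq_eq X (padic_seq_const 0)"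
    using padic_seq_norm_tendsto[of X] padic_seq_norm_eqI[of X 0]
    by (auto simp: padic_seq_eq.rep_eq padic_seq_const.rep_eq padic_vanishes_def)
qed

lemma padic_norm_mult: "padic_norm (x * y) = padic_norm x * padic_norm y"
proof (transfer, rule padic_seq_norm_eqI)
  fix X Y :: "'p padic_seq"
  show "(\<lambda>n. padic_abs CARD('p) (Rep_padic_seq (padic_seq_mult X Y) n))
          \<longlonglongrightarrow> padic_seq_norm X * padic_seq_norm Y"
    by (simp add: padic_seq_mult.rep_eq padic_abs_mult[OF prime_card])
       (intro tendsto_mult padic_seq_norm_tendsto)
qed

lemma padic_norm_uminus [simp]: "padic_norm (- x) = padic_norm x"
proof (transfer, rule padic_seq_norm_eqI)
  fix X :: "'p padic_seq"
  show "(\<lambda>n. padic_abs CARD('p) (Rep_padic_seq (padic_seq_minus X) n)) \<longlonglongrightarrow> padic_seq_norm X"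
    using padic_seq_norm_tendsto[of X] by (simp add: padic_seq_minus.rep_eq prime_card)
qed

lemma padic_norm_add: "padic_norm (x + y) \<le> max (padic_norm x) (padic_norm y)"
proof (transfer, rule LIMSEQ_le[OF padic_seq_norm_tendsto])
  fix X Y :: "'p padic_seq"
  show "(\<lambda>n. max (padic_abs CARD('p) (Rep_padic_seq X n)) (padic_abs CARD('p) (Rep_padic_seq Y n)))
          \<longlonglongrightarrow> max (padic_seq_norm X) (padic_seq_norm Y)"
    by (intro tendsto_max padic_seq_norm_tendsto)
  show "\<exists>N. \<forall>n\<ge>N. padic_abs CARD('p) (Rep_padic_seq (padic_seq_add X Y) n)
          \<le> max (padic_abs CARD('p) (Rep_padic_seq X n)) (padic_abs CARD('p) (Rep_padic_seq Y n))"
    by (simp add: padic_seq_add.rep_eq padic_abs_add[OF prime_card])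
qed

end

lemma padic_norm_of_rat: "padic_norm (of_rat q :: 'p::prime_card padic) = padic_abs CARD('p) q"
  unfolding padic_of_rat_eq_of_rat[symmetric]
  by (transfer, rule padic_seq_norm_eqI) (simp add: padic_seq_const.rep_eq)

lemma padic_norm_diff: "padic_norm (x - y) \<le> max (padic_norm x) (padic_norm (y :: 'p::prime_card padic))"
  using padic_norm_add[of x "- y"] by simp

lemma padic_norm_minus_commute: "padic_norm (x - y) = padic_norm (y - (x :: 'p::prime_card padic))"
  using padic_norm_uminus[of "x - y"] by simp

instantiation padic :: (prime_card) metric_space
begin

definition dist_padic :: "'a padic \<Rightarrow> 'a padic \<Rightarrow> real" where
  "dist_padic x y = padic_norm (x - y)"

definition uniformity_padic :: "('a padic \<times> 'a padic) filter" where
  "uniformity_padic = (INF e\<in>{0<..}. principal {(x, y). dist x y < e})"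

definition open_padic :: "'a padic set \<Rightarrow> bool" where
  "open_padic U \<longleftrightarrow> (\<forall>x\<in>U. \<forall>\<^sub>F (x', y) in uniformity. x' = x \<longrightarrow> y \<in> U)"

instance
proof
  fix x y z :: "'a padic"
  show "dist x y = 0 \<longleftrightarrow> x = y" by (simp add: dist_padic_def)
  have "dist x y \<le> max (dist x z) (dist y z)"
    using padic_norm_diff[of "x - z" "y - z"] by (simp add: dist_padic_def)
  thus "dist x y \<le> dist x z + dist y z"
    using padic_norm_nonneg[of "x - z"] padic_norm_nonneg[of "y - z"]
    by (simp add: dist_padic_def del: padic_norm_nonneg)
qed (rule uniformity_padic_def open_padic_def)+

end


lemma padic_norm_of_int: "padic_norm (of_int n :: 'p::prime_card padic) = padic_abs CARD('p) (of_int n)"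
  using padic_norm_of_rat[of "of_int n", where 'p = 'p] by simp

lemma padic_norm_0 [simp]: "padic_norm 0 = 0"
  by (subst padic_norm_eq_0) simp

lemma padic_norm_inverse: "padic_norm (inverse x) = inverse (padic_norm (x :: 'p::prime_card padic))"
proof (cases "x = 0")
  case False
  have "padic_norm (inverse x) * padic_norm x = padic_norm (inverse x * x)"
    by (simp only: padic_norm_mult)
  also have "\<dots> = 1" using False padic_norm_of_int[of 1, where 'p = 'p] by (simp add: prime_card)
  finally show ?thesis using False by (simp add: field_simps)
qed simp

lemma padic_norm_power: "padic_norm (x ^ n) = padic_norm (x :: 'p::prime_card padic) ^ n"
  using padic_norm_of_int[of 1, where 'p = 'p]
  by (induction n) (simp_all add: padic_norm_mult prime_card)

lemma padic_norm_power_int: "padic_norm (x powi j) = padic_norm (x :: 'p::prime_card padic) powi j"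
  by (simp add: power_int_def padic_norm_power padic_norm_inverse)

lemma padic_abs_of_int_le:
  assumes p: "prime p" and n: "int p ^ k dvd n"
  shows "padic_abs p (of_int n) \<le> real p powi (- int k)"
proof (cases "n = 0")
  case False
  have "\<not> is_unit (int p)" using p by (rule prime_int_not_unit)
  hence "k \<le> multiplicity (int p) n" using n False by (intro multiplicity_geI) auto
  moreover have "rat_val p (of_int n) = int (multiplicity (int p) n)"
    using rat_val_fraction[OF p False, of 1] by simp
  ultimately show ?thesis using False prime_ge_1_nat[OF p]
    by (auto simp: padic_abs_def intro!: power_int_increasing)
qed (auto simp: power_int_minus)

lemma padic_abs_of_int_eq_1:
  assumes p: "prime p" and n: "\<not> int p dvd n"
  shows "padic_abs p (of_int n) = 1"
proof -
  have "n \<noteq> 0" using n by auto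
  hence "rat_val p (of_int n) = 0"
    using rat_val_fraction[OF p, of n 1] n by (simp add: not_dvd_imp_multiplicity_0)
  thus ?thesis using \<open>n \<noteq> 0\<close> by (simp add: padic_abs_def)
qed

lemma padic_norm_p: "padic_norm (of_nat CARD('p) :: 'p::prime_card padic) = inverse (real CARD('p))"
proof -
  let ?P = "CARD('p)"
  have p: "prime ?P" by (rule prime_card)
  have "rat_val ?P (of_nat ?P) = int (multiplicity (int ?P) (int ?P))"
    using rat_val_fraction[OF p, of "int ?P" 1] prime_gt_0_nat[OF p] by simp
  also have "\<dots> = 1" using p by simp
  finally have "padic_abs ?P (of_nat ?P) = inverse (real ?P)"
    using prime_gt_0_nat[OF p] by (simp add: padic_abs_def power_int_minus)
  thus ?thesis using padic_norm_of_int[of "int ?P", where 'p = 'p] by simp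
qed

lemma padic_norm_p_powi:
  "padic_norm (of_nat CARD('p) powi j :: 'p::prime_card padic) = real CARD('p) powi (- j)"
  by (simp add: padic_norm_power_int padic_norm_p power_int_inverse power_int_minus)

lemma padic_dense:
  fixes \<alpha> :: "'p::prime_card padic"
  assumes e: "e > 0"
  obtains q where "padic_norm (\<alpha> - of_rat q) \<le> e"
proof -
  obtain X :: "'p padic_seq" where X: "\<alpha> = abs_padic X" 
    using padic.abs_induct[of "\<lambda>z. \<exists>X. z = abs_padic X" \<alpha>] by blast
  have "padic_Cauchy CARD('p) (Rep_padic_seq X)" using Rep_padic_seq[of X] by simp
  then obtain N where N: "\<forall>m\<ge>N. \<forall>n\<ge>N. padic_abs CARD('p) (Rep_padic_seq X m - Rep_padic_seq X n) < e"
    using e unfolding padic_Cauchy_def by blast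
  define q where "q = Rep_padic_seq X N"
  have "\<alpha> - of_rat q = abs_padic (padic_seq_diff X (padic_seq_const q))"
    unfolding X padic_of_rat_eq_of_rat[symmetric] by (simp add: padic_of_rat.abs_eq minus_padic.abs_eq)
  hence "padic_norm (\<alpha> - of_rat q) = padic_seq_norm (padic_seq_diff X (padic_seq_const q))"
    by (simp add: padic_norm.abs_eq)
  also have "\<dots> \<le> e"
    by (rule LIMSEQ_le_const2[OF padic_seq_norm_tendsto])
       (use N in \<open>force simp: padic_seq_diff.rep_eq padic_seq_const.rep_eq q_def intro!: exI[of _ N] less_imp_le\<close>)
  finally show ?thesis using that by blast
qed


section \<open>The Browkin function\<close>

definition browkin_expansion :: "'p::prime_card padic \<Rightarrow> (int \<Rightarrow> int) \<Rightarrow> bool" where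
  "browkin_expansion \<alpha> x \<longleftrightarrow>
     (\<forall>j. 2 * \<bar>x j\<bar> < int CARD('p)) \<and>
     (\<exists>k. (\<forall>j<k. x j = 0) \<and>
          (\<lambda>i. of_int (x (k + int i)) * of_nat CARD('p) powi (k + int i)) sums \<alpha>)"

lemma browkin_digit_exists:
  fixes \<alpha> :: "'p::prime_card padic"
  assumes odd: "odd CARD('p)" and \<alpha>: "padic_norm \<alpha> \<le> 1"
  shows "\<exists>d::int. 2 * \<bar>d\<bar> < int CARD('p) \<and> padic_norm (\<alpha> - of_int d) \<le> inverse (real CARD('p))"
proof -
  define p where "p = CARD('p)"
  have p: "prime p" unfolding p_def by (rule prime_card)
  have p1: "real p > 1" using prime_gt_1_nat[OF p] by simp
  obtain q where q: "padic_norm (\<alpha> - of_rat q) \<le> inverse (real p)"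
    using padic_dense[of "inverse (real p)" \<alpha>] p1 by auto
  have "padic_norm (\<alpha> - (\<alpha> - of_rat q)) \<le> max (padic_norm \<alpha>) (padic_norm (\<alpha> - of_rat q))"
    by (rule padic_norm_diff)
  also have "\<dots> \<le> 1"
    using \<alpha> order_trans[OF q, of 1] p1 inverse_le_1_iff[of "real p"] by auto
  finally have q1: "padic_abs p q \<le> 1" by (simp add: padic_norm_of_rat p_def)
  obtain a b where ab: "quotient_of q = (a, b)" by fastforce
  have b: "b > 0" "coprime a b" "q = of_int a / of_int b"
    using quotient_of_denom_pos[OF ab] quotient_of_coprime[OF ab] quotient_of_div[OF ab] by auto
  have pb: "\<not> int p dvd b"
  proof
    assume *: "int p dvd b"
    hence pa: "\<not> int p dvd a" using b(2) prime_int_not_unit[OF p] coprime_common_divisor by blast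
    hence "padic_abs p (of_int a) = 1" by (rule padic_abs_of_int_eq_1[OF p])
    moreover have "padic_abs p (of_int b) \<le> real p powi (- int 1)"
      by (rule padic_abs_of_int_le[OF p]) (use * in simp)
    moreover have "padic_abs p (of_int a) = padic_abs p q * padic_abs p (of_int b)"
      using b by (simp add: padic_abs_mult[OF p, symmetric])
    ultimately have "1 \<le> padic_abs p (of_int b)" "padic_abs p (of_int b) \<le> inverse (real p)"
      using q1 mult_right_mono[OF q1, of "padic_abs p (of_int b)"] by (auto simp: power_int_minus)
    moreover have "inverse (real p) < 1" using p1 by (simp add: inverse_less_1_iff)
    ultimately show False by linarith
  qed
  hence "coprime b (int p)" using p prime_imp_coprime[of "int p" b] by (simp add: coprime_commute)
  then obtain c where c: "[b * c = 1] (mod int p)" using cong_solve_coprime_int by blast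
  define r where "r = (a * c) mod int p"
  define d where "d = (if 2 * r < int p then r else r - int p)"
  have r: "0 \<le> r" "r < int p" unfolding r_def using p1 by (auto intro: pos_mod_bound)
  obtain h where "int p = 2 * h + 1" using odd by (metis oddE even_of_nat p_def)
  hence d1: "2 * \<bar>d\<bar> < int p" using r unfolding d_def by (cases "2 * r < int p") auto
  have "[r = a * c] (mod int p)" by (simp add: r_def cong_def)
  moreover have "[r - int p = r] (mod int p)" by (simp add: cong_def)
  ultimately have "[d = a * c] (mod int p)" unfolding d_def by (auto intro: cong_trans)
  hence "[b * d = b * (a * c)] (mod int p)" by (rule cong_scalar_left)
  also have "b * (a * c) = a * (b * c)" by simp
  also have "[a * (b * c) = a * 1] (mod int p)" using c by (rule cong_scalar_left)
  finally have "int p dvd a - b * d" by (simp add: cong_iff_dvd_diff dvd_diff_commute)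
  hence "padic_abs p (of_int (a - b * d)) \<le> real p powi (- int 1)"
    by (intro padic_abs_of_int_le[OF p]) simp
  moreover have "padic_abs p (of_int b) = 1" by (rule padic_abs_of_int_eq_1[OF p pb])
  moreover have "(of_int (a - b * d) :: rat) = (q - of_int d) * of_int b"
    using b by (simp add: field_simps)
  ultimately have "padic_abs p (q - of_int d) \<le> inverse (real p)"
    by (simp add: padic_abs_mult[OF p] power_int_minus del: of_int_diff of_int_mult)
  hence "padic_norm (of_rat q - of_int d :: 'p padic) \<le> inverse (real p)"
    using padic_norm_of_rat[of "q - of_int d", where 'p = 'p] by (simp add: p_def of_rat_diff)
  hence "padic_norm (\<alpha> - of_int d) \<le> inverse (real p)"
    using padic_norm_add[of "\<alpha> - of_rat q" "of_rat q - of_int d"] q by simp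
  thus ?thesis using d1 unfolding p_def by blast
qed

lemma padic_sumsI:
  fixes \<alpha> :: "'p::prime_card padic"
  assumes "\<And>n. padic_norm (\<alpha> - (\<Sum>i<n. f i)) \<le> C * inverse (real CARD('p)) ^ n"
  shows "f sums \<alpha>"
proof -
  have p1: "real CARD('p) > 1" using prime_gt_1_nat[OF prime_card[where 'a = 'p]] by simp
  have "(\<lambda>n. C * inverse (real CARD('p)) ^ n) \<longlonglongrightarrow> C * 0"
    using p1 by (intro tendsto_mult tendsto_const LIMSEQ_realpow_zero) (auto simp: field_simps)
  hence "(\<lambda>n. dist (\<Sum>i<n. f i) \<alpha>) \<longlonglongrightarrow> 0"
    by (intro real_tendsto_sandwich[of "\<lambda>_. 0" "\<lambda>n. dist (\<Sum>i<n. f i) \<alpha>" sequentially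
          "\<lambda>n. C * inverse (real CARD('p)) ^ n"])
       (use assms in \<open>auto simp: dist_padic_def padic_norm_minus_commute[of _ \<alpha>]\<close>)
  thus ?thesis unfolding sums_def by (subst tendsto_dist_iff)
qed

lemma browkin_expansion_exists:
  fixes \<alpha> :: "'p::prime_card padic"
  assumes odd: "odd CARD('p)"
  shows "\<exists>x. browkin_expansion \<alpha> x"
proof -
  define p where "p = CARD('p)"
  have p1: "real p > 1" using prime_gt_1_nat[OF prime_card[where 'a = 'p]] by (simp add: p_def)
  define \<pi> :: "'p padic" where "\<pi> = of_nat p"
  have \<pi>: "\<pi> \<noteq> 0" using p1 by (simp add: \<pi>_def)
  have n\<pi>: "padic_norm (\<pi> powi j) = real p powi (- j)" for j
    unfolding \<pi>_def p_def by (rule padic_norm_p_powi)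
  obtain m where m: "padic_norm \<alpha> < real p ^ m" using real_arch_pow[OF p1] by blast
  define k where "k = - int m"
  define dig where "dig \<beta> = (SOME d::int. 2 * \<bar>d\<bar> < int p \<and> padic_norm (\<beta> - of_int d) \<le> inverse (real p))"
    for \<beta> :: "'p padic"
  have dig: "2 * \<bar>dig \<beta>\<bar> < int p" "padic_norm (\<beta> - of_int (dig \<beta>)) \<le> inverse (real p)"
    if "padic_norm \<beta> \<le> 1" for \<beta>
    using someI_ex[OF browkin_digit_exists[OF odd that]] unfolding dig_def p_def by blast+
  define A where "A = rec_nat (\<alpha> / \<pi> powi k) (\<lambda>_ \<beta>. (\<beta> - of_int (dig \<beta>)) / \<pi>)"
  have A0: "A 0 = \<alpha> / \<pi> powi k" and AS: "A (Suc n) = (A n - of_int (dig (A n))) / \<pi>" for n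
    by (unfold A_def) simp_all
  have A: "padic_norm (A n) \<le> 1" for n
  proof (induction n)
    case 0
    have "padic_norm (A 0) = padic_norm \<alpha> * inverse (real p powi (- k))"
      unfolding A0 divide_inverse padic_norm_mult padic_norm_inverse n\<pi> ..
    also have "\<dots> = padic_norm \<alpha> / real p ^ m" by (simp add: k_def divide_inverse)
    also have "\<dots> \<le> 1" using m by (intro divide_le_eq_1[THEN iffD2]) auto
    finally show ?case .
  next
    case (Suc n)
    have "padic_norm \<pi> = inverse (real p)" unfolding \<pi>_def p_def by (rule padic_norm_p)
    hence "padic_norm (A (Suc n)) = padic_norm (A n - of_int (dig (A n))) * real p"
      unfolding AS divide_inverse padic_norm_mult padic_norm_inverse by simp
    also have "\<dots> \<le> inverse (real p) * real p"
      using dig(2)[OF Suc] by (intro mult_right_mono) auto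
    also have "\<dots> = 1" using p1 by simp
    finally show ?case by simp
  qed
  define x where "x j = (if j < k then 0 else dig (A (nat (j - k))))" for j
  have xk: "x (k + int i) = dig (A i)" for i by (simp add: x_def)
  have part: "\<alpha> = (\<Sum>i<n. of_int (x (k + int i)) * \<pi> powi (k + int i)) + \<pi> powi (k + int n) * A n" for n
  proof (induction n)
    case 0
    show ?case using \<pi> by (simp add: A0)
  next
    case (Suc n)
    have "\<pi> powi (k + int (Suc n)) * A (Suc n) = \<pi> powi (k + int n) * \<pi> * ((A n - of_int (dig (A n))) / \<pi>)"
      using \<pi> power_int_add_1[of \<pi> "k + int n"] by (simp add: AS algebra_simps)
    also have "\<dots> = \<pi> powi (k + int n) * A n - of_int (x (k + int n)) * \<pi> powi (k + int n)"
      using \<pi> by (simp add: xk field_simps)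
    finally show ?case using Suc by simp
  qed
  have "(\<lambda>i. of_int (x (k + int i)) * \<pi> powi (k + int i)) sums \<alpha>"
  proof (rule padic_sumsI)
    fix n
    have "\<alpha> - (\<Sum>i<n. of_int (x (k + int i)) * \<pi> powi (k + int i)) = \<pi> powi (k + int n) * A n"
      using part[of n] by (simp add: algebra_simps)
    hence "padic_norm (\<alpha> - (\<Sum>i<n. of_int (x (k + int i)) * \<pi> powi (k + int i)))
             = real p powi (- k - int n) * padic_norm (A n)"
      by (simp add: padic_norm_mult n\<pi>)
    also have "\<dots> \<le> real p powi (- k - int n) * 1"
      using A[of n] p1 by (intro mult_left_mono) auto
    also have "\<dots> = real p powi (- k) * inverse (real p) ^ n"
      using p1 by (simp add: power_int_diff field_simps power_inverse)
    finally show "padic_norm (\<alpha> - (\<Sum>i<n. of_int (x (k + int i)) * \<pi> powi (k + int i)))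
             \<le> real p powi (- k) * inverse (real CARD('p)) ^ n" by (simp add: p_def)
  qed
  moreover have "2 * \<bar>x j\<bar> < int p" for j
    using dig(1)[OF A] p1 by (simp add: x_def)
  moreover have "\<forall>j<k. x j = 0" by (simp add: x_def)
  ultimately show ?thesis unfolding browkin_expansion_def \<pi>_def p_def by blast
qed


lemma padic_norm_sum_le:
  fixes f :: "'b \<Rightarrow> 'p::prime_card padic"
  assumes "\<And>i. i \<in> A \<Longrightarrow> padic_norm (f i) \<le> C" and "C \<ge> 0"
  shows "padic_norm (\<Sum>i\<in>A. f i) \<le> C"
  using assms
proof (induction A rule: infinite_finite_induct)
  case (insert i A)
  hence "padic_norm (\<Sum>i\<in>A. f i) \<le> C" "padic_norm (f i) \<le> C" by auto
  thus ?case using insert.hyps padic_norm_add[of "f i" "\<Sum>i\<in>A. f i"] by simp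
qed auto

lemma padic_abs_of_int_le_1: "prime p \<Longrightarrow> padic_abs p (of_int n) \<le> 1"
  using padic_abs_of_int_le[of p 0 n] by simp

lemma browkin_expansion_remainder:
  fixes \<alpha> :: "'p::prime_card padic"
  assumes "browkin_expansion \<alpha> x"
  obtains k where "\<forall>j<k. x j = 0"
    and "\<And>m J. m \<le> k \<Longrightarrow> k \<le> J \<Longrightarrow>
      padic_norm (\<alpha> - (\<Sum>j=m..<J. of_int (x j) * of_nat CARD('p) powi j)) \<le> real CARD('p) powi (- J)"
proof -
  define p where "p = CARD('p)"
  have p: "prime p" unfolding p_def by (rule prime_card)
  have p1: "real p > 1" using prime_gt_1_nat[OF p] by simp
  define t where "t j = (of_int (x j) * of_nat p powi j :: 'p padic)" for j
  have t: "padic_norm (t j) \<le> real p powi (- j)" for j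
  proof -
    have "padic_norm (t j) = padic_abs p (of_int (x j)) * real p powi (- j)"
      by (simp add: t_def padic_norm_mult padic_norm_p_powi padic_norm_of_int p_def)
    also have "\<dots> \<le> 1 * real p powi (- j)"
      using p1 by (intro mult_right_mono padic_abs_of_int_le_1[OF p]) auto
    finally show ?thesis by simp
  qed
  obtain k where k: "\<forall>j<k. x j = 0" and sums: "(\<lambda>i. t (k + int i)) sums \<alpha>"
    using assms unfolding browkin_expansion_def t_def p_def by blast
  have part: "(\<Sum>i<n. t (k + int i)) = (\<Sum>j=k..<k + int n. t j)" for n
    by (rule sum.reindex_bij_witness[of _ "\<lambda>j. nat (j - k)" "\<lambda>i. k + int i"]) auto
  have "padic_norm (\<alpha> - (\<Sum>j=m..<J. t j)) \<le> real p powi (- J)" if mk: "m \<le> k" and kJ: "k \<le> J" for m J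
  proof -
    have pos: "real p powi (- J) > 0" using p1 by (intro zero_less_power_int) simp
    have "(\<lambda>n. dist (\<Sum>i<n. t (k + int i)) \<alpha>) \<longlonglongrightarrow> 0"
      using sums unfolding sums_def by (subst (asm) tendsto_dist_iff)
    hence "\<forall>\<^sub>F n in sequentially. dist (\<Sum>i<n. t (k + int i)) \<alpha> < real p powi (- J)"
      using pos by (rule order_tendstoD(2))
    then obtain N0 where N0: "\<forall>n\<ge>N0. dist (\<Sum>i<n. t (k + int i)) \<alpha> < real p powi (- J)"
      unfolding eventually_sequentially by blast
    define N where "N = max N0 (nat (J - k))"
    have kN: "J \<le> k + int N" unfolding N_def by linarith
    have "padic_norm (\<alpha> - (\<Sum>j=k..<k + int N. t j)) \<le> real p powi (- J)"
      using N0[rule_format, of N] unfolding part dist_padic_def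
      by (simp add: N_def padic_norm_minus_commute[of \<alpha>])
    moreover have "padic_norm (\<Sum>j=J..<k + int N. t j) \<le> real p powi (- J)"
      using p1 pos by (intro padic_norm_sum_le order_trans[OF t] power_int_increasing) auto
    moreover have "(\<Sum>j=k..<k + int N. t j) = (\<Sum>j=k..<J. t j) + (\<Sum>j=J..<k + int N. t j)"
      using kJ kN by (subst sum.union_disjoint[symmetric]) (auto intro!: sum.cong simp: ivl_disj_un)
    moreover have "(\<Sum>j=m..<J. t j) = (\<Sum>j=k..<J. t j)"
      using k mk by (intro sum.mono_neutral_right) (auto simp: t_def)
    ultimately show ?thesis
      using padic_norm_add[of "\<alpha> - (\<Sum>j=k..<k + int N. t j)" "\<Sum>j=J..<k + int N. t j"]
      by (simp add: algebra_simps)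
  qed
  thus ?thesis using k that unfolding t_def p_def by blast
qed

theorem browkin_expansion_unique:
  fixes \<alpha> :: "'p::prime_card padic"
  assumes odd: "odd CARD('p)"
  shows "\<exists>!x. browkin_expansion \<alpha> x"
proof (rule ex_ex1I[OF browkin_expansion_exists[OF odd]])
  fix x y assume x: "browkin_expansion \<alpha> x" and y: "browkin_expansion \<alpha> y"
  define p where "p = CARD('p)"
  have p: "prime p" unfolding p_def by (rule prime_card)
  have p1: "real p > 1" using prime_gt_1_nat[OF p] by simp
  define t where "t z J m = (\<Sum>j=m..<J. of_int (z j) * of_nat p powi j :: 'p padic)" for z :: "int \<Rightarrow> int" and J m
  obtain k where k: "\<forall>j<k. x j = 0"
      "\<And>m J. m \<le> k \<Longrightarrow> k \<le> J \<Longrightarrow> padic_norm (\<alpha> - t x J m) \<le> real p powi (- J)"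
    using browkin_expansion_remainder[OF x] unfolding t_def p_def by metis
  obtain l where l: "\<forall>j<l. y j = 0"
      "\<And>m J. m \<le> l \<Longrightarrow> l \<le> J \<Longrightarrow> padic_norm (\<alpha> - t y J m) \<le> real p powi (- J)"
    using browkin_expansion_remainder[OF y] unfolding t_def p_def by metis
  define m where "m = min k l"
  show "x = y"
  proof (rule ccontr)
    assume "x \<noteq> y"
    then obtain j0 where j0: "x j0 \<noteq> y j0" by blast
    have "\<exists>j. x j \<noteq> y j \<and> (\<forall>i<j. x i = y i)"
    proof -
      define Q where "Q n \<longleftrightarrow> x (m + int n) \<noteq> y (m + int n)" for n
      have "j0 \<ge> m" using j0 k(1) l(1) unfolding m_def by (metis linorder_not_le min_less_iff_conj)
      hence "Q (nat (j0 - m))" using j0 by (simp add: Q_def)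
      hence 1: "Q (LEAST n. Q n)" by (rule LeastI)
      have "x i = y i" if "i < m + int (LEAST n. Q n)" for i
      proof (cases "i < m")
        case True
        thus ?thesis using k(1) l(1) by (simp add: m_def)
      next
        case False
        have "nat (i - m) < (LEAST n. Q n)" using that False by linarith
        hence "\<not> Q (nat (i - m))" by (rule not_less_Least)
        thus ?thesis using False by (simp add: Q_def)
      qed
      thus ?thesis using 1 unfolding Q_def by blast
    qed
    then obtain j where j: "x j \<noteq> y j" "\<forall>i<j. x i = y i" by blast
    have jm: "j \<ge> m" using j(1) k(1) l(1) unfolding m_def by (metis linorder_not_le min_less_iff_conj)
    define J where "J = max (j + 1) (max k l)"
    have diff: "padic_norm (t x J m - t y J m) \<le> real p powi (- J)"
    proof -
      have "padic_norm (\<alpha> - t y J m) \<le> real p powi (- J)" "padic_norm (\<alpha> - t x J m) \<le> real p powi (- J)"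
        using k(2)[of m J] l(2)[of m J] by (auto simp: m_def J_def)
      thus ?thesis using padic_norm_diff[of "\<alpha> - t y J m" "\<alpha> - t x J m"] by simp
    qed
    define e where "e i = (of_int (x i - y i) * of_nat p powi i :: 'p padic)" for i
    have "t x J m - t y J m = (\<Sum>i=m..<J. e i)"
      by (simp add: t_def e_def sum_subtractf algebra_simps)
    also have "\<dots> = (\<Sum>i=j..<J. e i)"
      using jm j(2) by (intro sum.mono_neutral_right) (auto simp: e_def)
    also have "{j..<J} = insert j {j + 1..<J}" by (auto simp: J_def)
    also have "(\<Sum>i\<in>insert j {j + 1..<J}. e i) = e j + (\<Sum>i=j + 1..<J. e i)" by simp
    finally have ej: "e j = (t x J m - t y J m) - (\<Sum>i=j + 1..<J. e i)" by simp
    have ei: "padic_norm (e i) = padic_abs p (of_int (x i - y i)) * real p powi (- i)" for i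
      unfolding e_def padic_norm_mult padic_norm_of_int p_def padic_norm_p_powi ..
    have "padic_norm (\<Sum>i=j + 1..<J. e i) \<le> real p powi (- (j + 1))"
    proof (rule padic_norm_sum_le)
      fix i assume i: "i \<in> {j + 1..<J}"
      have "padic_norm (e i) \<le> 1 * real p powi (- i)" unfolding ei
        using p1 by (intro mult_right_mono padic_abs_of_int_le_1[OF p]) auto
      also have "\<dots> \<le> real p powi (- (j + 1))" using i p1 by (auto intro!: power_int_increasing)
      finally show "padic_norm (e i) \<le> real p powi (- (j + 1))" .
    qed (use p1 in auto)
    moreover have "real p powi (- J) \<le> real p powi (- (j + 1))"
      using p1 by (intro power_int_increasing) (auto simp: J_def)
    ultimately have "padic_norm (e j) \<le> real p powi (- (j + 1))"
      using diff padic_norm_diff[of "t x J m - t y J m" "\<Sum>i=j + 1..<J. e i"] unfolding ej by linarith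
    moreover have "padic_norm (e j) = real p powi (- j)"
    proof -
      have "2 * \<bar>x j\<bar> < int p" "2 * \<bar>y j\<bar> < int p"
        using x y unfolding browkin_expansion_def p_def by auto
      hence "\<bar>x j - y j\<bar> < int p" by linarith
      hence "\<not> int p dvd x j - y j" using j(1) dvd_imp_le_int[of "x j - y j" "int p"] by auto
      hence "padic_abs p (of_int (x j - y j)) = 1" by (rule padic_abs_of_int_eq_1[OF p])
      thus ?thesis unfolding ei by (simp del: of_int_diff)
    qed
    moreover have "real p powi (- (j + 1)) < real p powi (- j)"
      using p1 by (intro power_int_strict_increasing) auto
    ultimately show False by linarith
  qed
qed

definition browkin_digits :: "'p::prime_card padic \<Rightarrow> int \<Rightarrow> int" where
  "browkin_digits \<alpha> = (THE x. browkin_expansion \<alpha> x)"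

(* The digit function x is total on the integers, with x j = 0 below the leading index k; hence
   the index set is finite. The value lies in Z[1/p] and is therefore taken in the rationals. *)
definition browkin_s :: "'p::prime_card padic \<Rightarrow> rat" where
  "browkin_s \<alpha> = (\<Sum>j | j \<le> 0 \<and> browkin_digits \<alpha> j \<noteq> 0.
                    of_int (browkin_digits \<alpha> j) * of_nat CARD('p) powi j)"


section \<open>The p-adic Jacobi--Perron algorithm in dimension 2\<close>

(* None: the algorithm has stopped before step n *)
fun jacobi_perron :: "'p::prime_card padic \<times> 'p padic \<Rightarrow> nat \<Rightarrow> ('p padic \<times> 'p padic) option" where
  "jacobi_perron z 0 = Some z"
| "jacobi_perron z (Suc n) =
     (case jacobi_perron z n of
        None \<Rightarrow> None
      | Some (\<alpha>, \<beta>) \<Rightarrow>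
          (let a = of_rat (browkin_s \<alpha>); b = of_rat (browkin_s \<beta>) in
             if \<beta> = b then None else Some (1 / (\<beta> - b), (\<alpha> - a) / (\<beta> - b))))"

(* partial quotients; only meaningful as long as the algorithm has not stopped *)
definition jp_quotient_a :: "'p::prime_card padic \<times> 'p padic \<Rightarrow> nat \<Rightarrow> rat" where
  "jp_quotient_a z n = browkin_s (fst (the (jacobi_perron z n)))"

definition jp_quotient_b :: "'p::prime_card padic \<times> 'p padic \<Rightarrow> nat \<Rightarrow> rat" where
  "jp_quotient_b z n = browkin_s (snd (the (jacobi_perron z n)))"

definition jp_purely_periodic :: "'p::prime_card padic \<times> 'p padic \<Rightarrow> nat \<Rightarrow> bool" where
  "jp_purely_periodic z N \<longleftrightarrow>
     N > 0 \<and> (\<forall>n. jacobi_perron z n \<noteq> None) \<and>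
     (\<forall>k. jp_quotient_a z (k + N) = jp_quotient_a z k \<and> jp_quotient_b z (k + N) = jp_quotient_b z k)"

definition jp_matrix :: "rat \<Rightarrow> rat \<Rightarrow> rat mat" where
  "jp_matrix a b = mat_of_rows_list 3 [[a, 1, 0], [b, 0, 1], [1, 0, 0]]"


section \<open>The exceptional condition\<close>

definition near_inverse_p :: "nat \<Rightarrow> rat \<Rightarrow> int \<Rightarrow> bool" where
  "near_inverse_p p x w \<longleftrightarrow>
     (x = 1 / of_nat p + of_int w \<or> x = - 1 / of_nat p + of_int w) \<and>
     of_int \<bar>w\<bar> \<le> (of_nat p - 1) / (2::rat) \<and> w \<noteq> 0"

(* The sign in the hypothesis on a0, the one in the hypothesis on a1 and the one in front of p in c
   are independent of each other. *)
definition exceptional :: "nat \<Rightarrow> rat \<Rightarrow> rat \<Rightarrow> rat \<Rightarrow> rat \<Rightarrow> bool" where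
  "exceptional p a0 a1 b0 b1 \<longleftrightarrow>
     (\<exists>w. near_inverse_p p a0 w \<and>
       ((padic_val p (a1 * of_nat p + 1) = padic_val p a1 + 1 \<and>
         padic_val p b1 = padic_val p a1 + 1 \<and> padic_val p b0 = 0)
        \<or>
        (\<exists>u. near_inverse_p p a1 u \<and>
          (\<exists>c \<in> {of_int (- w * u) + of_nat p, of_int (- w * u) - of_nat p}.
             b0 = 0 \<and> b1 = c \<or> b1 = 0 \<and> b0 = c))))"

end

theory Submission
  imports Defs
begin

text \<open>
  Write T = a0 a1 + b0 + b1 and S = b0 b1 - a0 - a1. The characteristic polynomial is
  P = X^3 - T X^2 + S X - 1, and a cubic over the rationals is reducible only if it has a rational
  root r.

  From its second step on, the algorithm produces complete quotients with |\<alpha>| > 1 and |\<beta>| < |\<alpha>| in the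
  p-adic absolute value. By periodicity, this also governs the partial quotients of index 0. So
  v_p(a) < 0 and v_p(b) > v_p(a) for each index, while the Euclidean absolute values of a and b are
  below p/2 (the normal form \<open>quotient_pair\<close>).

  The root r is a unit of \<int>[1/p], that is, r = e p^t with e = \<plusminus>1. The Euclidean bounds on T and S leave
  only t = -1, 0, 1, and the p-adic size of T excludes t = -1 and t = 0
  (\<open>rational_root_is_plus_minus_p\<close>). For r = e p, the equation P(r) = 0 becomes

    (p a0 + e) (p a1 + e) = e p (p - e b0) (p - e b1)   (\<open>relation_of_root\<close>).

  Comparing p-adic valuations of the factors, v_p(a0) = -1 and p a0 + e is divisible by p, after
  interchanging the indices if necessary. This means that a0 = - e/p + w with an integer w, and the
  Euclidean bounds give 0 \<noteq> |w| < p/2. The valuations of the remaining factors then lead to the two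
  alternatives (\<open>exceptional_of_relation\<close>).
\<close>

section \<open>The characteristic polynomial in period two\<close>

text \<open>
  In a factorisation of a cubic into two non-constant factors one factor is linear.
\<close>

lemma irreducible_cubic_if_no_root:
  fixes P :: "'a::field poly"
  assumes deg: "degree P = 3" and no_root: "\<And>x. poly P x \<noteq> 0"
  shows "irreducible P"
proof (rule irreducibleI)
  show "P \<noteq> 0" "\<not> P dvd 1" using deg by (auto simp: poly_dvd_1)
next
  have linear_root: "\<exists>x. poly q x = 0" if q: "degree q = 1" for q :: "'a poly"
  proof -
    obtain d c where "q = [:c, d:]" "d \<noteq> 0"
      using q by (rule degree1_coeffs)
    hence "poly q (- c / d) = 0" by simp
    thus ?thesis ..
  qed
  fix q s assume P: "P = q * s"
  have nz: "q \<noteq> 0" "s \<noteq> 0" using P deg by auto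
  hence "degree q + degree s = 3" using P deg degree_mult_eq[of q s] by simp
  moreover have "degree q \<noteq> 1" "degree s \<noteq> 1"
    using linear_root[of q] linear_root[of s] no_root P by auto
  ultimately have "degree q = 0 \<or> degree s = 0" by linarith
  thus "q dvd 1 \<or> s dvd 1" using nz is_unit_iff_degree by auto
qed

lemma det_2:
  fixes A :: "'a::comm_ring_1 mat"
  assumes A: "A \<in> carrier_mat 2 2"
  shows "det A = A $$ (0,0) * A $$ (1,1) - A $$ (0,1) * A $$ (1,0)"
proof -
  have minor: "mat_delete A 0 j \<in> carrier_mat 1 1" for j
    using mat_delete_carrier[OF A, of 0 j] by simp
  have "det A = (\<Sum>j<2. A $$ (0, j) * cofactor A 0 j)"
    by (rule laplace_expansion_row[OF A]) simp
  thus ?thesis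
    unfolding cofactor_def det_single[OF minor] using A by (simp add: numeral_2_eq_2 mat_delete_def)
qed

lemma det_3:
  fixes A :: "'a::comm_ring_1 mat"
  assumes A: "A \<in> carrier_mat 3 3"
  shows "det A = A $$ (0,0) * (A $$ (1,1) * A $$ (2,2) - A $$ (1,2) * A $$ (2,1))
               - A $$ (0,1) * (A $$ (1,0) * A $$ (2,2) - A $$ (1,2) * A $$ (2,0))
               + A $$ (0,2) * (A $$ (1,0) * A $$ (2,1) - A $$ (1,1) * A $$ (2,0))"
proof -
  have minor: "mat_delete A 0 j \<in> carrier_mat 2 2" for j
    using mat_delete_carrier[OF A, of 0 j] by simp
  have "det A = (\<Sum>j<3. A $$ (0, j) * cofactor A 0 j)"
    by (rule laplace_expansion_row[OF A]) simp
  also have "\<dots> = A $$ (0,0) * cofactor A 0 0 + A $$ (0,1) * cofactor A 0 1 + A $$ (0,2) * cofactor A 0 2"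
    by (simp add: numeral_3_eq_3 numeral_2_eq_2)
  finally show ?thesis
    unfolding cofactor_def det_2[OF minor] using A by (simp add: mat_delete_def numeral_2_eq_2 algebra_simps)
qed

lemma jp_matrix_product:
  "jp_matrix a0 b0 * jp_matrix a1 b1
     = mat_of_rows_list 3 [[a0 * a1 + b1, a0, 1], [b0 * a1 + 1, b0, 0], [a1, 1, 0]]"
  by (rule eq_matI)
     (auto simp: jp_matrix_def mat_of_rows_list_def scalar_prod_def less_Suc_eq numeral_3_eq_3)

lemma poly_char_poly_3:
  fixes A :: "'a::comm_ring_1 mat"
  assumes A: "A \<in> carrier_mat 3 3"
  shows "poly (char_poly A) x
           = (x - A $$ (0,0)) * ((x - A $$ (1,1)) * (x - A $$ (2,2)) - A $$ (1,2) * A $$ (2,1))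
           + A $$ (0,1) * (- A $$ (1,0) * (x - A $$ (2,2)) - A $$ (1,2) * A $$ (2,0))
           - A $$ (0,2) * (A $$ (1,0) * A $$ (2,1) + (x - A $$ (1,1)) * A $$ (2,0))"
proof -
  have C: "char_poly_matrix A \<in> carrier_mat 3 3" using A by simp
  have "char_poly_matrix A $$ (i, j) = (if i = j then [:- (A $$ (i, j)), 1:] else [:- (A $$ (i, j)):])"
    if "i < 3" "j < 3" for i j
    using that A by (simp add: char_poly_matrix_def)
  thus ?thesis
    unfolding char_poly_def det_3[OF C] by (simp add: algebra_simps)
qed

lemma poly_char_poly_period_two:
  "poly (char_poly (jp_matrix a0 b0 * jp_matrix a1 b1)) x
     = x ^ 3 - (a0 * a1 + b0 + b1) * x ^ 2 + (b0 * b1 - a0 - a1) * x - 1"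
proof -
  define M where "M = mat_of_rows_list 3 [[a0 * a1 + b1, a0, 1], [b0 * a1 + 1, b0, 0], [a1, 1, 0]]"
  have M: "M \<in> carrier_mat 3 3" by (rule carrier_matI) (simp_all add: M_def mat_of_rows_list_def)
  have entries: "M $$ (0,0) = a0 * a1 + b1" "M $$ (0,1) = a0" "M $$ (0,2) = 1"
    "M $$ (1,0) = b0 * a1 + 1" "M $$ (1,1) = b0" "M $$ (1,2) = 0"
    "M $$ (2,0) = a1" "M $$ (2,1) = 1" "M $$ (2,2) = 0"
    by (simp_all add: M_def mat_of_rows_list_def)
  show ?thesis
    unfolding jp_matrix_product M_def[symmetric] poly_char_poly_3[OF M] entries
    by (simp add: algebra_simps power2_eq_square power3_eq_cube)
qed

section \<open>Rational roots of monic cubics with constant term -1\<close>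

text \<open>
  The constant 7/12 is 1/4 + 1/3: for a prime p \<ge> 3 and R = p^2, quantities below p/2 combine to
  coefficients of size at most p^2/4 + p \<le> (7/12) p^2. A root of size at least R \<ge> 9 would make
  its cube dominate the other three terms.
\<close>

lemma monic_cubic_root_size:
  fixes y T S :: "'a::linordered_field"
  assumes root: "y ^ 3 - T * y ^ 2 + S * y - 1 = 0"
    and R: "9 \<le> R" and T: "12 * \<bar>T\<bar> \<le> 7 * R" and S: "12 * \<bar>S\<bar> \<le> 7 * R"
  shows "\<bar>y\<bar> < R"
proof (rule ccontr)
  assume "\<not> \<bar>y\<bar> < R"
  hence y: "R \<le> \<bar>y\<bar>" by simp
  hence y9: "9 \<le> \<bar>y\<bar>" using R by linarith
  have T': "12 * \<bar>T\<bar> \<le> 7 * \<bar>y\<bar>" and S': "12 * \<bar>S\<bar> \<le> 7 * \<bar>y\<bar>" using T S y by linarith+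
  have "y ^ 3 = T * y ^ 2 - S * y + 1" using root by (simp add: algebra_simps)
  hence "\<bar>y\<bar> ^ 3 = \<bar>T * y ^ 2 - S * y + 1\<bar>" by (simp add: power_abs[symmetric])
  also have "\<dots> \<le> \<bar>T * y ^ 2\<bar> + \<bar>S * y\<bar> + 1" by linarith
  finally have "12 * \<bar>y\<bar> ^ 3 \<le> (12 * \<bar>T\<bar>) * \<bar>y\<bar> ^ 2 + (12 * \<bar>S\<bar>) * \<bar>y\<bar> + 12"
    by (simp add: abs_mult)
  also have "\<dots> \<le> (7 * \<bar>y\<bar>) * \<bar>y\<bar> ^ 2 + (7 * \<bar>y\<bar>) * \<bar>y\<bar> + 12"
    using T' S' by (intro add_mono mult_right_mono) auto
  finally have le: "5 * \<bar>y\<bar> ^ 3 \<le> 7 * \<bar>y\<bar> ^ 2 + 12"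
    by (simp add: power2_eq_square power3_eq_cube)
  have sq: "81 \<le> \<bar>y\<bar> ^ 2" using power_mono[OF y9, of 2] by simp
  have "9 * \<bar>y\<bar> ^ 2 \<le> \<bar>y\<bar> * \<bar>y\<bar> ^ 2" using y9 by (intro mult_right_mono) auto
  hence "45 * \<bar>y\<bar> ^ 2 \<le> 5 * \<bar>y\<bar> ^ 3" by (simp add: power2_eq_square power3_eq_cube)
  thus False using le sq by linarith
qed

text \<open>
  Reversing the cubic exchanges T and S. An upper bound for the roots that is symmetric in T and S
  therefore also bounds their inverses.
\<close>

lemma inverse_root:
  fixes y T S :: "'a::field"
  assumes root: "y ^ 3 - T * y ^ 2 + S * y - 1 = 0"
  shows "inverse y ^ 3 - S * inverse y ^ 2 + T * inverse y - 1 = 0"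
proof -
  have y: "y \<noteq> 0" using root by auto
  hence "(inverse y ^ 3 - S * inverse y ^ 2 + T * inverse y - 1) * y ^ 3
      = - (y ^ 3 - T * y ^ 2 + S * y - 1)"
    by (simp add: field_simps power2_eq_square power3_eq_cube)
  thus ?thesis using root y by simp
qed

text \<open>
  The cubic is monic over \<int>[1/p] with constant term -1, so its rational roots are units of \<int>[1/p].
  Concretely, p^N r is a root of a monic integer polynomial whose constant term is a power of p.
\<close>

lemma rational_root_power_of_prime:
  fixes r :: rat and T S :: int
  assumes p: "prime p"
    and root: "r ^ 3 - of_int T / of_nat p ^ N * r ^ 2 + of_int S / of_nat p ^ N * r - 1 = 0"
  obtains e t :: int where "e = 1 \<or> e = - 1" "r = of_int e * of_nat p powi t"
proof -
  have p0: "(of_nat p :: rat) \<noteq> 0" using prime_gt_0_nat[OF p] by simp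
  define q where "q = int p ^ N"
  define y where "y = r * of_int q"
  have q0: "(of_int q :: rat) \<noteq> 0" using p0 by (simp add: q_def)
  have root': "r ^ 3 - of_int T / of_int q * r ^ 2 + of_int S / of_int q * r - 1 = 0"
    using root by (simp add: q_def)
  have r_y: "r = y / of_int q" using q0 by (simp add: y_def)
  have y_root: "y ^ 3 = of_int T * y ^ 2 - of_int (S * q) * y + of_int (q ^ 3)"
    using root' q0 unfolding r_y by (simp add: field_simps power2_eq_square power3_eq_cube)
  obtain c d where cd: "quotient_of y = (c, d)" by fastforce
  have d: "d > 0" "coprime c d" "y = of_int c / of_int d"
    using quotient_of_denom_pos[OF cd] quotient_of_coprime[OF cd] quotient_of_div[OF cd] by auto
  have "(of_int (c ^ 3) :: rat) = of_int (T * c ^ 2 * d - S * q * c * d ^ 2 + q ^ 3 * d ^ 3)"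
    using y_root d(1) unfolding d(3) by (simp add: field_simps power2_eq_square power3_eq_cube)
  hence c3: "c ^ 3 = T * c ^ 2 * d - S * q * c * d ^ 2 + q ^ 3 * d ^ 3" by (simp only: of_int_eq_iff)
  hence "c ^ 3 = d * (T * c ^ 2 - S * q * c * d + q ^ 3 * d ^ 2)"
    by (simp add: algebra_simps power2_eq_square power3_eq_cube)
  hence "d dvd c ^ 3" by simp
  hence "is_unit d" using d(2) by (meson coprime_absorb_left coprime_commute coprime_power_right_iff)
  hence d1: "d = 1" using d(1) by simp
  have "q ^ 3 = c * (c ^ 2 - T * c + S * q)"
    using c3 d1 by (simp add: algebra_simps power2_eq_square power3_eq_cube)
  hence "c dvd int p ^ (N * 3)" unfolding q_def power_mult by simp
  then obtain j where j: "\<bar>c\<bar> = int p ^ j"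
    using divides_primepow[of "int p" c "N * 3"] p by auto
  define e where "e = sgn c"
  have "c \<noteq> 0" using j p0 by auto
  hence "e = 1 \<or> e = - 1" unfolding e_def by (auto simp: sgn_if)
  moreover have "(of_int c :: rat) = of_int e * of_int \<bar>c\<bar>" unfolding e_def by (auto simp: sgn_if)
  hence "r = of_int e * of_nat p powi (int j - int N)"
    using p0 d(3) d1 j by (simp add: r_y q_def power_int_diff)
  ultimately show ?thesis by (rule that)
qed

section \<open>Partial quotients in lowest terms\<close>

lemma rat_val_div_power:
  assumes p: "prime p" and m: "\<not> int p dvd m"
  shows "rat_val p (of_int m / of_nat p ^ j) = - int j"
proof -
  have m0: "m \<noteq> 0" using m by auto
  have p0: "int p \<noteq> 0" using prime_gt_0_nat[OF p] by simp
  have "rat_val p (of_int m / of_int (int p ^ j)) = - int j"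
    unfolding rat_val_fraction[OF p m0 power_not_zero[OF p0]]
    using m p by (simp add: not_dvd_imp_multiplicity_0)
  thus ?thesis by simp
qed

lemma padic_val_div_power:
  assumes p: "prime p" and m: "\<not> int p dvd m"
  shows "padic_val p (of_int m / of_nat p ^ j) = - ereal (real j)"
  using m prime_gt_0_nat[OF p] by (auto simp: padic_val_def rat_val_div_power[OF p m])

lemma padic_abs_div_power:
  assumes p: "prime p" and m: "\<not> int p dvd m"
  shows "padic_abs p (of_int m / of_nat p ^ j) = real p ^ j"
  using m prime_gt_0_nat[OF p] by (auto simp: padic_abs_def rat_val_div_power[OF p m])

text \<open>
  The shape of two partial quotients a, b of one step: v_p(a) = -(H + 1) < v_p(b), and both lie in \<int>[1/p] and have Euclidean absolute value below p/2. Clearing denominators turns everything that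
  follows into statements about the integers m and n.
\<close>

definition quotient_pair :: "nat \<Rightarrow> nat \<Rightarrow> rat \<Rightarrow> rat \<Rightarrow> int \<Rightarrow> int \<Rightarrow> bool" where
  "quotient_pair p H a b m n \<longleftrightarrow>
     a = of_int m / of_nat p ^ (H + 1) \<and> b = of_int n / of_nat p ^ H \<and> \<not> int p dvd m \<and>
     2 * \<bar>m\<bar> < int p ^ (H + 2) \<and> 2 * \<bar>n\<bar> < int p ^ (H + 1)"

lemma quotient_pair_abs_less:
  assumes p: "0 < p" and q: "quotient_pair p H a b m n"
  shows "2 * \<bar>a\<bar> < of_nat p" "2 * \<bar>b\<bar> < of_nat p"
proof -
  have pow: "(0 :: rat) < of_nat p ^ k" for k using p by simp
  have "(of_int (2 * \<bar>m\<bar>) :: rat) < of_int (int p ^ (H + 2))"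
    "(of_int (2 * \<bar>n\<bar>) :: rat) < of_int (int p ^ (H + 1))"
    using q unfolding quotient_pair_def by (simp_all only: of_int_less_iff)
  thus "2 * \<bar>a\<bar> < of_nat p" "2 * \<bar>b\<bar> < of_nat p"
    using q pow[of "H + 1"] pow[of H] p
    by (simp_all add: quotient_pair_def abs_divide divide_less_eq algebra_simps power_add power2_eq_square)
qed

lemma browkin_digits_expansion:
  fixes \<alpha> :: "'p::prime_card padic"
  assumes "odd CARD('p)"
  shows "browkin_expansion \<alpha> (browkin_digits \<alpha>)"
  unfolding browkin_digits_def by (rule theI'[OF browkin_expansion_unique[OF assms]])

lemma browkin_s_eq_sum:
  fixes \<alpha> :: "'p::prime_card padic"
  assumes "\<forall>j < - int n. browkin_digits \<alpha> j = 0"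
  shows "browkin_s \<alpha> = (\<Sum>i\<le>n. of_int (browkin_digits \<alpha> (- int i)) / of_nat CARD('p) ^ i)"
proof -
  have "browkin_s \<alpha> = (\<Sum>j\<in>{- int n..0}. of_int (browkin_digits \<alpha> j) * of_nat CARD('p) powi j)"
    unfolding browkin_s_def
    by (rule sum.mono_neutral_left) (use assms in \<open>auto simp: not_less[symmetric]\<close>)
  also have "\<dots> = (\<Sum>i\<le>n. of_int (browkin_digits \<alpha> (- int i)) / of_nat CARD('p) ^ i)"
    by (rule sum.reindex_bij_witness[of _ "\<lambda>i. - int i" "\<lambda>j. nat (- j)"])
       (auto simp: power_int_def divide_inverse power_inverse)
  finally show ?thesis .
qed

text \<open>
  Horner evaluation of the balanced digits. In integers the bound is 2 |c| \<le> p^(n+1) - 1, which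
  survives c \<mapsto> p c + x because 2 |x| \<le> p - 1.
\<close>

lemma balanced_digit_sum:
  fixes x :: "nat \<Rightarrow> int"
  assumes p: "0 < p" and x: "\<And>i. 2 * \<bar>x i\<bar> < int p"
  shows "\<exists>c. (\<Sum>i\<le>n. of_int (x i) / of_nat p ^ i :: rat) = of_int c / of_nat p ^ n \<and>
             2 * \<bar>c\<bar> < int p ^ (n + 1)"
proof (induction n)
  case 0
  show ?case using x[of 0] by (intro exI[of _ "x 0"]) simp
next
  case (Suc n)
  then obtain c where c: "(\<Sum>i\<le>n. of_int (x i) / of_nat p ^ i :: rat) = of_int c / of_nat p ^ n"
    "2 * \<bar>c\<bar> < int p ^ (n + 1)" by blast
  have "(\<Sum>i\<le>Suc n. of_int (x i) / of_nat p ^ i :: rat) = of_int (int p * c + x (Suc n)) / of_nat p ^ Suc n"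
    using p by (simp add: c(1) add_divide_distrib)
  moreover have "2 * \<bar>int p * c + x (Suc n)\<bar> < int p ^ (Suc n + 1)"
  proof -
    have "2 * \<bar>c\<bar> + 1 \<le> int p ^ (n + 1)" using c(2) by simp
    hence "int p * (2 * \<bar>c\<bar> + 1) \<le> int p * int p ^ (n + 1)" by (intro mult_left_mono) auto
    moreover have "\<bar>int p * c + x (Suc n)\<bar> \<le> int p * \<bar>c\<bar> + \<bar>x (Suc n)\<bar>"
      using abs_triangle_ineq[of "int p * c" "x (Suc n)"] by (simp add: abs_mult)
    ultimately show ?thesis using x[of "Suc n"] by (simp add: algebra_simps)
  qed
  ultimately show ?case by blast
qed

lemma browkin_s_fraction:
  fixes \<alpha> :: "'p::prime_card padic"
  assumes odd: "odd CARD('p)"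
  obtains c n where "browkin_s \<alpha> = of_int c / of_nat CARD('p) ^ n" "2 * \<bar>c\<bar> < int CARD('p) ^ (n + 1)"
    "padic_norm (\<alpha> - of_rat (browkin_s \<alpha>)) \<le> inverse (real CARD('p))"
proof -
  define p where "p = CARD('p)"
  have p1: "1 < p" unfolding p_def by (rule prime_gt_1_nat[OF prime_card])
  note dig = browkin_digits_expansion[OF odd, of \<alpha>]
  define x where "x = browkin_digits \<alpha>"
  have small: "2 * \<bar>x j\<bar> < int p" for j
    using dig unfolding browkin_expansion_def x_def p_def by blast
  obtain k where k: "\<forall>j<k. x j = 0"
    and rem: "\<And>m J. m \<le> k \<Longrightarrow> k \<le> J \<Longrightarrow>
      padic_norm (\<alpha> - (\<Sum>j=m..<J. of_int (x j) * of_nat p powi j)) \<le> real p powi (- J)"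
    using browkin_expansion_remainder[OF dig] unfolding x_def p_def by metis
  define n where "n = nat (- k)"
  have kn: "- int n \<le> k" by (simp add: n_def)
  have s: "browkin_s \<alpha> = (\<Sum>i\<le>n. of_int (x (- int i)) / of_nat p ^ i)"
    unfolding x_def p_def by (rule browkin_s_eq_sum) (use k kn in \<open>auto simp: x_def\<close>)
  obtain c where c: "browkin_s \<alpha> = of_int c / of_nat p ^ n" "2 * \<bar>c\<bar> < int p ^ (n + 1)"
    using balanced_digit_sum[of p "\<lambda>i. x (- int i)" n] small p1 unfolding s by auto
  \<comment> \<open>Cutting off at J keeps exactly the digits of index at most 0: if k > 1, those of index
    1, \<dots>, k - 1 vanish.\<close>
  define J where "J = max k 1"
  have "of_rat (browkin_s \<alpha>) = (\<Sum>i\<le>n. of_int (x (- int i)) / of_nat p ^ i :: 'p padic)"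
    unfolding s by (simp add: of_rat_sum of_rat_divide of_rat_power)
  also have "\<dots> = (\<Sum>j=- int n..<1. of_int (x j) * of_nat p powi j)"
    by (rule sum.reindex_bij_witness[of _ "\<lambda>j. nat (- j)" "\<lambda>i. - int i"])
       (auto simp: power_int_def divide_inverse power_inverse)
  also have "\<dots> = (\<Sum>j=- int n..<J. of_int (x j) * of_nat p powi j)"
    using k by (intro sum.mono_neutral_left) (auto simp: J_def)
  finally have "padic_norm (\<alpha> - of_rat (browkin_s \<alpha>)) \<le> real p powi (- J)"
    using rem[OF kn, of J] by (simp add: J_def)
  also have "\<dots> \<le> real p powi (- 1)" using p1 by (intro power_int_increasing) (auto simp: J_def)
  finally have "padic_norm (\<alpha> - of_rat (browkin_s \<alpha>)) \<le> inverse (real p)"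
    by (simp add: power_int_minus)
  thus ?thesis using that c unfolding p_def by blast
qed

text \<open>
  An element of \<int>[1/p] has the denominator that its p-adic absolute value predicts. This brings the
  values of the Browkin function, computed with an unreduced power of p below, into the form \<open>quotient_pair\<close>.
\<close>

lemma fraction_prime_power_normalize:
  assumes p: "prime p" and le: "padic_abs p (of_int c / of_nat p ^ n) \<le> real p ^ k"
  obtains c' where "(of_int c / of_nat p ^ n :: rat) = of_int c' / of_nat p ^ k"
proof (cases "c = 0")
  case True
  thus ?thesis using that[of 0] by simp
next
  case False
  have p0: "(of_nat p :: rat) \<noteq> 0" and p1: "1 < real p" using prime_gt_1_nat[OF p] by simp_all
  obtain d where d: "c = int p ^ multiplicity (int p) c * d" "\<not> int p dvd d"
    using multiplicity_decompose'[of c "int p"] False prime_int_not_unit[OF p] by metis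
  define i where "i = multiplicity (int p) c"
  have frac: "(of_int c / of_nat p ^ n :: rat) = of_nat p ^ i * of_int d / of_nat p ^ n"
    by (subst d(1)) (simp add: i_def)
  have "n \<le> k + i"
  proof (rule ccontr)
    assume n: "\<not> n \<le> k + i"
    hence "(of_int c / of_nat p ^ n :: rat) = of_int d / of_nat p ^ (n - i)"
      using p0 unfolding frac by (simp add: power_diff field_simps)
    hence "real p ^ (n - i) \<le> real p ^ k" using padic_abs_div_power[OF p d(2)] le by simp
    moreover have "real p ^ k < real p ^ (n - i)" using n p1 by (intro power_strict_increasing) auto
    ultimately show False by simp
  qed
  then obtain l where "k + i = n + l" using le_iff_add by blast
  hence "(of_nat p :: rat) ^ k * of_nat p ^ i = of_nat p ^ n * of_nat p ^ l"
    by (simp add: power_add[symmetric])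
  hence "(of_int c / of_nat p ^ n :: rat) = of_int (int p ^ l * d) / of_nat p ^ k"
    using p0 unfolding frac by (simp add: field_simps)
  thus ?thesis by (rule that)
qed

text \<open>
  Both inequalities say that the fraction has Euclidean absolute value below p/2, which does not depend
  on the power of p chosen as denominator.
\<close>

lemma balanced_fraction_rescale:
  assumes p: "0 < p" and eq: "(of_int c / of_nat p ^ n :: rat) = of_int c' / of_nat p ^ k"
    and c: "2 * \<bar>c\<bar> < int p ^ (n + 1)"
  shows "2 * \<bar>c'\<bar> < int p ^ (k + 1)"
proof -
  have "(of_int (c * int p ^ k) :: rat) = of_int (c' * int p ^ n)"
    using eq p by (simp add: field_simps)
  hence eq': "c * int p ^ k = c' * int p ^ n" by (simp only: of_int_eq_iff)
  have "(2 * \<bar>c'\<bar>) * int p ^ n = 2 * \<bar>c' * int p ^ n\<bar>" by (simp add: abs_mult)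
  also have "\<dots> = 2 * \<bar>c\<bar> * int p ^ k" unfolding eq'[symmetric] by (simp add: abs_mult)
  also have "\<dots> < int p ^ (n + 1) * int p ^ k" using c p by (intro mult_strict_right_mono) auto
  also have "\<dots> = int p ^ (k + 1) * int p ^ n" by (simp add: mult_ac)
  finally show ?thesis using p by (auto dest: mult_right_less_imp_less)
qed

text \<open>
  Since |\<alpha>| > 1, the Browkin function does not change the p-adic absolute value of \<alpha>, and the one
  of \<beta> stays below it. The denominators can therefore be normalised to p^(H+1) and p^H.
\<close>

lemma quotient_pairI:
  fixes \<alpha> \<beta> :: "'p::prime_card padic"
  assumes odd: "odd CARD('p)"
    and \<alpha>: "1 < padic_norm \<alpha>" and \<beta>: "padic_norm \<beta> < padic_norm \<alpha>"
  obtains H m n where "quotient_pair CARD('p) H (browkin_s \<alpha>) (browkin_s \<beta>) m n"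
proof -
  define p where "p = CARD('p)"
  have p: "prime p" unfolding p_def by (rule prime_card)
  have p1: "1 < real p" using prime_gt_1_nat[OF p] by simp
  have inv: "inverse (real p) < 1" using p1 by (simp add: inverse_less_1_iff)
  obtain c i where c: "browkin_s \<alpha> = of_int c / of_nat p ^ i" "2 * \<bar>c\<bar> < int p ^ (i + 1)"
    and \<alpha>': "padic_norm (\<alpha> - of_rat (browkin_s \<alpha>)) < 1"
    using browkin_s_fraction[OF odd, of \<alpha>] inv unfolding p_def by (metis order_le_less_trans)
  obtain d j where d: "browkin_s \<beta> = of_int d / of_nat p ^ j" "2 * \<bar>d\<bar> < int p ^ (j + 1)"
    and \<beta>': "padic_norm (\<beta> - of_rat (browkin_s \<beta>)) < 1"
    using browkin_s_fraction[OF odd, of \<beta>] inv unfolding p_def by (metis order_le_less_trans)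
  have a_abs: "padic_abs p (browkin_s \<alpha>) = padic_norm \<alpha>"
    using padic_norm_diff[of \<alpha> "\<alpha> - of_rat (browkin_s \<alpha>)"]
      padic_norm_add[of "\<alpha> - of_rat (browkin_s \<alpha>)" "of_rat (browkin_s \<alpha>)"] \<alpha> \<alpha>'
    by (simp add: padic_norm_of_rat p_def)
  have b_abs: "padic_abs p (browkin_s \<beta>) < padic_norm \<alpha>"
    using padic_norm_diff[of \<beta> "\<beta> - of_rat (browkin_s \<beta>)"] \<alpha> \<beta> \<beta>'
    by (simp add: padic_norm_of_rat p_def)
  have "browkin_s \<alpha> \<noteq> 0" using a_abs \<alpha> by auto
  define v where "v = rat_val p (browkin_s \<alpha>)"
  have norm_v: "padic_norm \<alpha> = real p powi (- v)"
    using a_abs \<open>browkin_s \<alpha> \<noteq> 0\<close> by (simp add: padic_abs_def v_def)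
  have "v < 0"
  proof (rule ccontr)
    assume "\<not> v < 0"
    hence "real p powi (- v) \<le> real p powi 0" using p1 by (intro power_int_increasing) auto
    thus False using \<alpha> norm_v by simp
  qed
  define H where "H = nat (- v - 1)"
  have H: "- v = int (H + 1)" using \<open>v < 0\<close> by (simp add: H_def)
  have norm_H: "padic_norm \<alpha> = real p ^ (H + 1)" unfolding norm_v H power_int_of_nat ..
  have "padic_abs p (of_int c / of_nat p ^ i) \<le> real p ^ (H + 1)"
    using a_abs norm_H c(1) by simp
  then obtain m where m: "(of_int c / of_nat p ^ i :: rat) = of_int m / of_nat p ^ (H + 1)"
    by (rule fraction_prime_power_normalize[OF p])
  have "padic_abs p (of_int d / of_nat p ^ j) \<le> real p ^ H"
  proof (cases "browkin_s \<beta> = 0")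
    case False
    hence "real p powi (- rat_val p (browkin_s \<beta>)) < real p powi (int (H + 1))"
      using b_abs norm_H by (simp add: padic_abs_def del: of_nat_add of_nat_Suc)
    hence "\<not> int (H + 1) \<le> - rat_val p (browkin_s \<beta>)"
      using p1 power_int_increasing[of "int (H + 1)" "- rat_val p (browkin_s \<beta>)" "real p"] by fastforce
    hence "real p powi (- rat_val p (browkin_s \<beta>)) \<le> real p powi (int H)"
      using p1 by (intro power_int_increasing) auto
    thus ?thesis using False d(1) by (simp add: padic_abs_def)
  qed (use d in auto)
  then obtain n where n: "(of_int d / of_nat p ^ j :: rat) = of_int n / of_nat p ^ H"
    by (rule fraction_prime_power_normalize[OF p])
  have "\<not> int p dvd m"
  proof
    assume "int p dvd m"
    then obtain m' where "m = int p * m'" ..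
    hence "browkin_s \<alpha> = of_int m' * inverse (of_nat p ^ H)"
      using c(1) m p1 by (simp add: divide_inverse)
    hence "padic_abs p (browkin_s \<alpha>) = padic_abs p (of_int m') * padic_abs p (of_int 1 / of_nat p ^ H)"
      by (simp add: padic_abs_mult[OF p, symmetric] divide_inverse)
    also have "\<dots> \<le> 1 * real p ^ H"
      using padic_abs_div_power[OF p, of 1 H] prime_int_not_unit[OF p]
      by (intro mult_mono padic_abs_of_int_le_1[OF p]) auto
    finally have "real p ^ (H + 1) \<le> real p ^ H" using a_abs norm_H by simp
    moreover have "real p ^ H < real p ^ (H + 1)" using p1 by (intro power_strict_increasing) auto
    ultimately show False by simp
  qed
  thus ?thesis
    using that[of H m n] balanced_fraction_rescale[OF _ m c(2)] balanced_fraction_rescale[OF _ n d(2)]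
      c(1) d(1) m n prime_gt_0_nat[OF p]
    unfolding quotient_pair_def p_def by simp
qed

text \<open>
  Inverting \<beta> - s(\<beta>), which is p-adically small, produces a large first component; the second one
  is this component multiplied by \<alpha> - s(\<alpha>), which is small as well.
\<close>

lemma jp_state_bounds:
  fixes z :: "'p::prime_card padic \<times> 'p padic"
  assumes odd: "odd CARD('p)" and Suc: "jacobi_perron z (Suc n) = Some (\<alpha>, \<beta>)"
  shows "1 < padic_norm \<alpha>" "padic_norm \<beta> < padic_norm \<alpha>"
proof -
  obtain \<alpha>' \<beta>' where prev: "jacobi_perron z n = Some (\<alpha>', \<beta>')"
    using Suc by (auto split: option.splits prod.splits)
  define a b where "a = (of_rat (browkin_s \<alpha>') :: 'p padic)" and "b = (of_rat (browkin_s \<beta>') :: 'p padic)"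
  have step: "\<beta>' \<noteq> b" "\<alpha> = inverse (\<beta>' - b)" "\<beta> = (\<alpha>' - a) * \<alpha>"
    using Suc prev by (auto simp: a_def b_def Let_def divide_inverse split: if_splits)
  have p1: "inverse (real CARD('p)) < 1"
    using prime_gt_1_nat[OF prime_card[where 'a = 'p]] by (simp add: inverse_less_1_iff)
  have "padic_norm (\<beta>' - b) < 1" "padic_norm (\<alpha>' - a) < 1"
    unfolding a_def b_def using browkin_s_fraction[OF odd] p1 by (metis order_le_less_trans)+
  moreover have "0 < padic_norm (\<beta>' - b)"
    using step(1) padic_norm_nonneg[of "\<beta>' - b"] by (simp add: less_le del: padic_norm_nonneg)
  ultimately show "1 < padic_norm \<alpha>" and "padic_norm \<beta> < padic_norm \<alpha>"
    unfolding step(3) by (simp_all add: step(2) padic_norm_inverse padic_norm_mult one_less_inverse)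
qed

lemma jp_quotient_pair:
  fixes z :: "'p::prime_card padic \<times> 'p padic"
  assumes "odd CARD('p)" and "jacobi_perron z (Suc n) \<noteq> None"
  obtains H m k where
    "quotient_pair CARD('p) H (jp_quotient_a z (Suc n)) (jp_quotient_b z (Suc n)) m k"
proof -
  obtain \<alpha> \<beta> where st: "jacobi_perron z (Suc n) = Some (\<alpha>, \<beta>)" using assms(2) by auto
  show ?thesis
    using quotient_pairI[OF assms(1) jp_state_bounds[OF assms(1) st]] that
    unfolding jp_quotient_a_def jp_quotient_b_def st by auto
qed

section \<open>Rational roots of the characteristic polynomial\<close>

lemma root_size:
  assumes p: "prime p" "odd p"
    and q0: "quotient_pair p H a0 b0 m0 n0" and q1: "quotient_pair p K a1 b1 m1 n1"
    and root: "r ^ 3 - (a0 * a1 + b0 + b1) * r ^ 2 + (b0 * b1 - a0 - a1) * r - 1 = 0"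
  shows "\<bar>r\<bar> < of_nat p ^ 2" "\<bar>inverse r\<bar> < of_nat p ^ 2"
proof -
  define x where "x = (of_nat p :: rat)"
  have "3 \<le> p" using p prime_ge_2_nat[of p] by (cases "p = 2") auto
  hence x3: "3 \<le> x" by (simp add: x_def)
  have bounds: "2 * \<bar>a0\<bar> < x" "2 * \<bar>b0\<bar> < x" "2 * \<bar>a1\<bar> < x" "2 * \<bar>b1\<bar> < x"
    using quotient_pair_abs_less[OF prime_gt_0_nat[OF p(1)]] q0 q1 unfolding x_def by blast+
  have "(2 * \<bar>a0\<bar>) * (2 * \<bar>a1\<bar>) \<le> x * x" "(2 * \<bar>b0\<bar>) * (2 * \<bar>b1\<bar>) \<le> x * x"
    using bounds x3 by (intro mult_mono; simp)+
  hence prods: "4 * \<bar>a0 * a1\<bar> \<le> x ^ 2" "4 * \<bar>b0 * b1\<bar> \<le> x ^ 2"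
    by (simp_all add: abs_mult power2_eq_square)
  have sq: "3 * x \<le> x ^ 2" using mult_right_mono[OF x3, of x] x3 by (simp add: power2_eq_square)
  have "12 * \<bar>a0 * a1 + b0 + b1\<bar> \<le> 7 * x ^ 2" "12 * \<bar>b0 * b1 - a0 - a1\<bar> \<le> 7 * x ^ 2"
    using prods bounds sq abs_triangle_ineq[of "a0 * a1 + b0" b1] abs_triangle_ineq[of "a0 * a1" b0]
      abs_triangle_ineq4[of "b0 * b1 - a0" a1] abs_triangle_ineq4[of "b0 * b1" a0] by simp_all
  moreover have "9 \<le> x ^ 2" using sq x3 by linarith
  ultimately show "\<bar>r\<bar> < of_nat p ^ 2" "\<bar>inverse r\<bar> < of_nat p ^ 2"
    using monic_cubic_root_size[OF root] monic_cubic_root_size[OF inverse_root[OF root]]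
    unfolding x_def by blast+
qed

text \<open>
  A rational root is e p^t, and its size restricts t to -1, 0, 1. The coefficient of X^2 has the
  large denominator p^N, N = H + K + 2, since its numerator T is congruent to m0 m1 modulo p. For t = 0
  and t = -1 the other three terms are not p-adically large enough to cancel it.
\<close>

lemma rational_root_is_plus_minus_p:
  assumes p: "prime p" "odd p"
    and q0: "quotient_pair p H a0 b0 m0 n0" and q1: "quotient_pair p K a1 b1 m1 n1"
    and root: "r ^ 3 - (a0 * a1 + b0 + b1) * r ^ 2 + (b0 * b1 - a0 - a1) * r - 1 = 0"
  obtains e :: int where "e = 1 \<or> e = - 1" "r = of_int e * of_nat p"
proof -
  have p0: "(of_nat p :: rat) \<noteq> 0" and p1: "(1 :: rat) < of_nat p"
    using prime_gt_1_nat[OF p(1)] by simp_all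
  define N where "N = H + K + 2"
  define X where "X = n0 * int p ^ (K + 1) + n1 * int p ^ (H + 1)"
  define T where "T = m0 * m1 + int p * X"
  define S where "S = n0 * n1 * int p ^ 2 - m0 * int p ^ (K + 1) - m1 * int p ^ (H + 1)"
  have q: "a0 = of_int m0 / of_nat p ^ (H + 1)" "b0 = of_int n0 / of_nat p ^ H"
    "a1 = of_int m1 / of_nat p ^ (K + 1)" "b1 = of_int n1 / of_nat p ^ K"
    "\<not> int p dvd m0" "\<not> int p dvd m1"
    using q0 q1 by (auto simp: quotient_pair_def)
  have T: "a0 * a1 + b0 + b1 = of_int T / of_nat p ^ N"
    and S: "b0 * b1 - a0 - a1 = of_int S / of_nat p ^ N"
    using p0 by (simp_all add: q N_def T_def X_def S_def field_simps power_add power2_eq_square)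
  have root': "r ^ 3 - of_int T / of_nat p ^ N * r ^ 2 + of_int S / of_nat p ^ N * r - 1 = 0"
    using root unfolding T S .
  obtain e t :: int where e: "e = 1 \<or> e = - 1" and r: "r = of_int e * of_nat p powi t"
    by (rule rational_root_power_of_prime[OF p(1) root'])
  have pT: "\<not> int p dvd T"
    using q p by (simp add: T_def dvd_add_left_iff prime_dvd_mult_iff)
  have abs_r: "\<bar>r\<bar> = of_nat p powi t" "\<bar>inverse r\<bar> = of_nat p powi (- t)"
    using e by (auto simp: r abs_mult power_int_minus)
  note size = root_size[OF p q0 q1 root, unfolded abs_r]
  have upper: "k < 2" if "(of_nat p :: rat) powi k < of_nat p ^ 2" for k :: int
  proof (rule ccontr)
    assume "\<not> k < 2"
    hence "(of_nat p :: rat) powi 2 \<le> of_nat p powi k" using p1 by (intro power_int_increasing) auto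
    thus False using that by simp
  qed
  have "t < 2" "- t < 2" using size upper by blast+
  then consider "t = 1" | "t = 0" | "t = - 1" by linarith
  thus ?thesis
  proof cases
    case 1
    thus ?thesis using that[OF e] r by simp
  next
    case 2
    hence "(of_int T :: rat) = of_int (int p ^ N * e + S * e - int p ^ N)"
      using root' p0 e unfolding r by (auto simp: field_simps)
    hence "T = int p ^ N * e + S * e - int p ^ N" by (simp only: of_int_eq_iff)
    moreover have "int p dvd S" "int p dvd int p ^ N" by (simp_all add: S_def N_def)
    ultimately show ?thesis using pT by simp
  next
    case 3
    have N: "N = Suc (H + K + 1)" by (simp add: N_def)
    have "(of_int T :: rat) = of_int (int p ^ (H + K + 1) * e + S * e * int p - int p ^ (N + 2))"
      using root' p0 e unfolding r 3 N
      by (auto simp: field_simps power_int_minus power2_eq_square power3_eq_cube)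
    hence "T = int p ^ (H + K + 1) * e + S * e * int p - int p ^ (N + 2)" by (simp only: of_int_eq_iff)
    thus ?thesis using pT by simp
  qed
qed

section \<open>The exceptional cases\<close>

text \<open>
  The sign of 1/p in the resulting decomposition is opposite to e. For odd p the bound |m/p| < p/2 only
  leaves 2 |w| < p + 1, and parity improves this to the required bound on w.
\<close>

lemma near_inverse_pI:
  assumes p: "prime p" "odd p" and e: "e = 1 \<or> e = - 1"
    and m: "m + e = int p * w" "2 * \<bar>m\<bar> < int p ^ 2" and w: "w \<noteq> 0"
  shows "near_inverse_p p (of_int m / of_nat p) w" "2 * \<bar>w\<bar> \<le> int p - 1"
proof -
  have p3: "3 \<le> p" using p prime_ge_2_nat[of p] by (cases "p = 2") auto
  have "2 * (int p * \<bar>w\<bar>) = 2 * \<bar>m + e\<bar>" using m by (simp add: abs_mult)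
  also have "\<dots> < int p * (int p + 1)"
  proof -
    have "2 * \<bar>m + e\<bar> \<le> 2 * \<bar>m\<bar> + 2" using e abs_triangle_ineq[of m e] by auto
    also have "\<dots> < int p ^ 2 + int p" using m(2) p3 by linarith
    finally show ?thesis by (simp add: algebra_simps power2_eq_square)
  qed
  finally have "2 * \<bar>w\<bar> < int p + 1" using p3
    by (metis (no_types, lifting) mult.left_commute mult_less_cancel_left_pos of_nat_0_less_iff
        order_less_le_trans zero_less_numeral)
  thus w_le: "2 * \<bar>w\<bar> \<le> int p - 1" using p(2) by presburger
  have "m = int p * w - e" using m by simp
  hence "(of_int m :: rat) = of_nat p * of_int w - of_int e" by simp
  hence "(of_int m / of_nat p :: rat) = - of_int e / of_nat p + of_int w"
    using p3 by (simp add: field_simps)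
  moreover have "of_int (2 * \<bar>w\<bar>) \<le> (of_int (int p - 1) :: rat)"
    using w_le by (simp only: of_int_le_iff)
  ultimately show "near_inverse_p p (of_int m / of_nat p) w"
    unfolding near_inverse_p_def using e w by auto
qed

lemma exponent_zero_if_dvd:
  fixes q m c :: int
  assumes m: "\<not> q dvd m" and dvd: "q dvd m + c * q ^ K"
  shows "K = 0"
proof (rule ccontr)
  assume "K \<noteq> 0"
  hence "q dvd c * q ^ K" by simp
  thus False using dvd m by (simp add: dvd_add_left_iff)
qed

text \<open>
  With x = p, this turns the vanishing of the characteristic polynomial at e p into an equality of two
  products, whose p-adic valuations can be read off factor by factor.
\<close>

lemma relation_of_root:
  fixes a0 a1 b0 b1 e x :: "'a::comm_ring_1"
  assumes e: "e = 1 \<or> e = - 1"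
    and root: "(e * x) ^ 3 - (a0 * a1 + b0 + b1) * (e * x) ^ 2 + (b0 * b1 - a0 - a1) * (e * x) - 1 = 0"
  shows "(x * a0 + e) * (x * a1 + e) = e * x * (x - e * b0) * (x - e * b1)"
proof -
  have "e * x * (x - e * b0) * (x - e * b1) - (x * a0 + e) * (x * a1 + e)
     = (e * x) ^ 3 - (a0 * a1 + b0 + b1) * (e * x) ^ 2 + (b0 * b1 - a0 - a1) * (e * x) - 1"
    using e by (auto simp: algebra_simps power2_eq_square power3_eq_cube)
  thus ?thesis using root by simp
qed

text \<open>
  After division by p the relation reads
  w (m1 + e p^K) = e (p - e n0) (p^(K+1) - e n1), where p does not divide w.
  If p does not divide the second factor on the left, neither n0 nor n1 is divisible by p, which gives
  all valuations in (i). If p does divide it, then K = 0 and one of n0, n1 is divisible by p, hence zero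
  by size; the relation then gives the other one, and this is (ii).
  One point needs care: condition (i) speaks of a1 p + 1 regardless of the sign e. If e = -1 and
  a1 = -1/p + u, its first equation fails; but then (i) holds with the indices interchanged.
\<close>

lemma exceptional_of_relation:
  assumes p: "prime p" "odd p" and e: "e = 1 \<or> e = - 1"
    and q0: "quotient_pair p 0 a0 b0 m0 n0" and q1: "quotient_pair p K a1 b1 m1 n1"
    and dvd: "int p dvd m0 + e"
    and rel: "(m0 + e) * (m1 + e * int p ^ K) = e * int p * (int p - e * n0) * (int p ^ (K + 1) - e * n1)"
  shows "exceptional p a0 a1 b0 b1 \<or> exceptional p a1 a0 b1 b0"
proof -
  have p3: "3 \<le> p" using p prime_ge_2_nat[of p] by (cases "p = 2") auto
  have pp: "prime (int p)" using p by simp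
  have two: "\<not> int p dvd 2" using p3 by (auto dest: zdvd_imp_le)
  have small: "z = 0" if "int p dvd z" "2 * \<bar>z\<bar> < int p" for z
    using that dvd_imp_le_int[of z "int p"] by (cases "z = 0") auto
  have a0: "a0 = of_int m0 / of_nat p" "b0 = of_int n0" "2 * \<bar>m0\<bar> < int p ^ 2" "2 * \<bar>n0\<bar> < int p"
    and m0: "\<not> int p dvd m0"
    and a1: "a1 = of_int m1 / of_nat p ^ (K + 1)" "b1 = of_int n1 / of_nat p ^ K"
      "2 * \<bar>m1\<bar> < int p ^ (K + 2)" "2 * \<bar>n1\<bar> < int p ^ (K + 1)"
    and m1: "\<not> int p dvd m1"
    using q0 q1 by (auto simp: quotient_pair_def power2_eq_square)
  obtain w where w: "m0 + e = int p * w" using dvd by blast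
  have rel': "w * (m1 + e * int p ^ K) = e * (int p - e * n0) * (int p ^ (K + 1) - e * n1)"
  proof -
    have "int p * (w * (m1 + e * int p ^ K)) = int p * (e * (int p - e * n0) * (int p ^ (K + 1) - e * n1))"
      using rel unfolding w by (simp add: mult_ac)
    thus ?thesis using p3 by simp
  qed
  have "int p - e * n0 > 0" "int p ^ (K + 1) - e * n1 > 0" using a0(4) a1(4) e by auto
  hence nz: "w * (m1 + e * int p ^ K) \<noteq> 0" unfolding rel' using e by auto
  hence w0: "w \<noteq> 0" by auto
  have near0: "near_inverse_p p a0 w" and w_le: "2 * \<bar>w\<bar> \<le> int p - 1"
    unfolding a0 by (rule near_inverse_pI[OF p e w a0(3) w0])+
  have pw: "\<not> int p dvd w" using small[of w] w_le w0 by auto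
  show ?thesis
  proof (cases "int p dvd m1 + e * int p ^ K")
    case False
    have "\<not> int p dvd e * (int p - e * n0) * (int p ^ (K + 1) - e * n1)"
      unfolding rel'[symmetric] using pw False prime_dvd_mult_iff[OF pp] by blast
    hence n: "\<not> int p dvd n0" "\<not> int p dvd n1" by auto
    have val: "padic_val p a1 = - ereal (real (K + 1))" "padic_val p b1 = - ereal (real K)"
        "padic_val p b0 = 0"
      using padic_val_div_power[OF p(1) m1, of "K + 1"] padic_val_div_power[OF p(1) n(2), of K]
        padic_val_div_power[OF p(1) n(1), of 0] a0 a1 by simp_all
    have frac: "a1 * of_nat p + 1 = of_int (m1 + int p ^ K) / of_nat p ^ K"
      unfolding a1 using p3 by (simp add: field_simps)
    show ?thesis
    proof (cases "int p dvd m1 + int p ^ K")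
      case False
      hence "padic_val p (a1 * of_nat p + 1) = - ereal (real K)"
        unfolding frac by (rule padic_val_div_power[OF p(1)])
      thus ?thesis using near0 val unfolding exceptional_def by auto
    next
      case True
      hence K: "K = 0" using exponent_zero_if_dvd[OF m1, of 1 K] by simp
      have e: "e = - 1" using e True \<open>\<not> int p dvd m1 + e * int p ^ K\<close> by auto
      obtain u where u: "m1 + 1 = int p * u" using True K by auto
      \<comment> \<open>For u = 0 the relation would express 2 w, which is at most p - 1, as a product of two numbers
        above p/2; this contradicts p - 1 \<le> p^2/4.\<close>
      have "u \<noteq> 0"
      proof
        assume "u = 0"
        hence "m1 = - 1" using u by simp
        hence "2 * w = (int p + n0) * (int p + n1)" using rel' K e by (simp add: algebra_simps)
        moreover have "int p * int p \<le> (2 * (int p + n0)) * (2 * (int p + n1))"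
          using a0(4) a1(4) K by (intro mult_mono) auto
        ultimately have "int p * int p \<le> 8 * w" by (simp add: algebra_simps)
        moreover have "1 * 1 \<le> (int p - 2) * (int p - 2)" using p3 by (intro mult_mono) auto
        ultimately show False using w_le by (simp add: algebra_simps)
      qed
      hence near1: "near_inverse_p p a1 u"
        using near_inverse_pI(1)[OF p, of 1 m1 u] u a1 K by (simp add: power2_eq_square)
      have "a0 * of_nat p + 1 = of_int (int p * w + 2) / of_nat p ^ 0"
        using w e p3 unfolding a0 by (simp add: field_simps)
      moreover have "\<not> int p dvd int p * w + 2" using two by (simp add: dvd_add_right_iff)
      ultimately have "padic_val p (a0 * of_nat p + 1) = 0"
        using padic_val_div_power[OF p(1), of "int p * w + 2" 0] by (simp add: zero_ereal_def add.commute)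
      moreover have "padic_val p a0 + 1 = 0"
        using padic_val_div_power[OF p(1) m0, of 1] a0 by (simp add: one_ereal_def zero_ereal_def)
      moreover have "padic_val p b1 = 0" using val K by (simp add: zero_ereal_def)
      ultimately have "exceptional p a1 a0 b1 b0"
        using near1 val(3) unfolding exceptional_def by metis
      thus ?thesis ..
    qed
  next
    case True
    hence K: "K = 0" by (rule exponent_zero_if_dvd[OF m1])
    obtain u where u: "m1 + e = int p * u" using True K by auto
    have "u \<noteq> 0" using nz K u by auto
    hence near1: "near_inverse_p p a1 u"
      using near_inverse_pI(1)[OF p e u] a1 K by (simp add: power2_eq_square)
    have rel2: "int p * (w * u) = e * (int p - e * n0) * (int p - e * n1)"
      using rel' K u by (simp add: mult_ac)
    hence "int p dvd e * (int p - e * n0) * (int p - e * n1)" by (metis dvd_triv_left)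
    hence "int p dvd n0 \<or> int p dvd n1"
      using e by (auto simp: prime_dvd_mult_iff[OF pp] dvd_diff_right_iff)
    hence n: "n0 = 0 \<or> n1 = 0" using small a0(4) a1(4) K by auto
    have solve: "n = - w * u + e * int p" if "int p * (w * u) = e * int p * (int p - e * n)" for n
    proof -
      have "int p * (w * u) = int p * (e * int p - e * e * n)" using that by (simp add: algebra_simps)
      hence "w * u = e * int p - e * e * n" using p3 by simp
      thus ?thesis using e by auto
    qed
    have c: "(of_int (- w * u + e * int p) :: rat) \<in> {of_int (- w * u) + of_nat p, of_int (- w * u) - of_nat p}"
      using e by auto
    have "b0 = 0 \<and> b1 = of_int (- w * u + e * int p) \<or> b1 = 0 \<and> b0 = of_int (- w * u + e * int p)"
      using n solve[of n0] solve[of n1] rel2 a0 a1 K by auto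
    thus ?thesis using near0 near1 c unfolding exceptional_def by blast
  qed
qed

text \<open>
  Multiplying the relation for the root e p by p^H p^K, its right-hand side becomes divisible by p.
  So p divides one factor on the left, and the situation is symmetric in the two indices.
\<close>

lemma exceptional_of_rational_root:
  assumes p: "prime p" "odd p"
    and q0: "quotient_pair p H a0 b0 m0 n0" and q1: "quotient_pair p K a1 b1 m1 n1"
    and root: "r ^ 3 - (a0 * a1 + b0 + b1) * r ^ 2 + (b0 * b1 - a0 - a1) * r - 1 = 0"
  shows "exceptional p a0 a1 b0 b1 \<or> exceptional p a1 a0 b1 b0"
proof -
  have p0: "(of_nat p :: rat) \<noteq> 0" using prime_gt_1_nat[OF p(1)] by simp
  have pp: "prime (int p)" using p by simp
  obtain e :: int where e: "e = 1 \<or> e = - 1" and r: "r = of_int e * of_nat p"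
    by (rule rational_root_is_plus_minus_p[OF p q0 q1 root])
  have q: "a0 = of_int m0 / of_nat p ^ (H + 1)" "b0 = of_int n0 / of_nat p ^ H"
    "a1 = of_int m1 / of_nat p ^ (K + 1)" "b1 = of_int n1 / of_nat p ^ K"
    "\<not> int p dvd m0" "\<not> int p dvd m1"
    using q0 q1 by (auto simp: quotient_pair_def)
  have e': "(of_int e :: rat) = 1 \<or> (of_int e :: rat) = - 1" using e by auto
  have rel: "(m0 + e * int p ^ H) * (m1 + e * int p ^ K)
      = e * int p * (int p ^ (H + 1) - e * n0) * (int p ^ (K + 1) - e * n1)"
  proof -
    have "(of_int ((m0 + e * int p ^ H) * (m1 + e * int p ^ K)) :: rat)
        = of_nat p ^ H * of_nat p ^ K * ((of_nat p * a0 + of_int e) * (of_nat p * a1 + of_int e))"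
      using p0 by (simp add: q field_simps)
    also have "\<dots> = of_nat p ^ H * of_nat p ^ K *
        (of_int e * of_nat p * (of_nat p - of_int e * b0) * (of_nat p - of_int e * b1))"
      using relation_of_root[OF e' root[unfolded r]] by simp
    also have "\<dots> = of_int (e * int p * (int p ^ (H + 1) - e * n0) * (int p ^ (K + 1) - e * n1))"
      using p0 by (simp add: q field_simps)
    finally show ?thesis by (simp only: of_int_eq_iff)
  qed
  have "int p dvd (m0 + e * int p ^ H) * (m1 + e * int p ^ K)" unfolding rel by simp
  hence "int p dvd m0 + e * int p ^ H \<or> int p dvd m1 + e * int p ^ K"
    by (simp add: prime_dvd_mult_iff[OF pp])
  thus ?thesis
  proof
    assume d: "int p dvd m0 + e * int p ^ H"
    have H: "H = 0" by (rule exponent_zero_if_dvd[OF _ d]) (use q in simp)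
    show ?thesis
      using exceptional_of_relation[OF p e q0[unfolded H] q1] d rel H by (simp add: mult_ac)
  next
    assume d: "int p dvd m1 + e * int p ^ K"
    have K: "K = 0" by (rule exponent_zero_if_dvd[OF _ d]) (use q in simp)
    show ?thesis
      using exceptional_of_relation[OF p e q1[unfolded K] q0] d rel K by (auto simp: mult_ac)
  qed
qed

section \<open>Irreducibility\<close>

theorem proposition12:
  fixes \<alpha>\<^sub>0 \<beta>\<^sub>0 :: "'p::prime_card padic"
    and p :: nat and a b :: "nat \<Rightarrow> rat" and P :: "rat poly"
  assumes "p = CARD('p)" and "odd p"
    and "jp_purely_periodic (\<alpha>\<^sub>0, \<beta>\<^sub>0) 2"
    and "a = jp_quotient_a (\<alpha>\<^sub>0, \<beta>\<^sub>0)" and "b = jp_quotient_b (\<alpha>\<^sub>0, \<beta>\<^sub>0)"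
    and "P = char_poly (jp_matrix (a 0) (b 0) * jp_matrix (a 1) (b 1))"
  shows "irreducible P \<or>
         exceptional p (a 0) (a 1) (b 0) (b 1) \<or> exceptional p (a 1) (a 0) (b 1) (b 0)"
proof (cases "\<exists>r. poly P r = 0")
  case False
  have "jp_matrix (a 0) (b 0) * jp_matrix (a 1) (b 1) \<in> carrier_mat 3 3"
    unfolding jp_matrix_product by (rule carrier_matI) (simp_all add: mat_of_rows_list_def)
  hence "degree P = 3" unfolding assms(6) using degree_monic_char_poly by blast
  thus ?thesis using False irreducible_cubic_if_no_root[of P] by blast
next
  case True
  then obtain r where r: "poly P r = 0" by blast
  have p: "prime p" "odd p" using assms(1,2) by (simp_all add: prime_card)
  have steps: "jacobi_perron (\<alpha>\<^sub>0, \<beta>\<^sub>0) n \<noteq> None" for n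
    using assms(3) by (simp add: jp_purely_periodic_def)
  have "a (0 + 2) = a 0" "b (0 + 2) = b 0"
    using assms(3) unfolding jp_purely_periodic_def assms(4,5) by blast+
  hence period: "a (Suc 1) = a 0" "b (Suc 1) = b 0" by simp_all
  \<comment> \<open>The input of the algorithm is arbitrary, so the index 0 is reached through the index 2.\<close>
  obtain H m0 n0 where "quotient_pair p H (a (Suc 1)) (b (Suc 1)) m0 n0"
    using jp_quotient_pair[OF assms(2)[unfolded assms(1)] steps, of 1]
    unfolding assms(1,4,5) by blast
  hence q0: "quotient_pair p H (a 0) (b 0) m0 n0" unfolding period .
  obtain K m1 n1 where "quotient_pair p K (a (Suc 0)) (b (Suc 0)) m1 n1"
    using jp_quotient_pair[OF assms(2)[unfolded assms(1)] steps, of 0]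
    unfolding assms(1,4,5) by blast
  hence q1: "quotient_pair p K (a 1) (b 1) m1 n1" by simp
  have "r ^ 3 - (a 0 * a 1 + b 0 + b 1) * r ^ 2 + (b 0 * b 1 - a 0 - a 1) * r - 1 = 0"
    using r unfolding assms(6) poly_char_poly_period_two .
  thus ?thesis using exceptional_of_rational_root[OF p q0 q1] by blast
qed

end
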